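(* Let $X$, $f$ and the sets $X_t$ ($t\in\mathbb{R}_+\cup\{+\infty\}$) be as in the context. Assume that $X$ contains a Lyapunov-stable equilibrium point of $f$, that $\overline{\tau}<+\infty$, and that one of the polynomials $g_i$ describing $X$ is equal to $R^2-|x|^2$ for some $R>0$. Let $T\in\mathbb{R}_+$ and let $k\ge k_{min}$ be an integer. Then the order-$k$ sum-of-squares problem $(D_k^T)$ defined in the context is an LMI problem (i.e. it can be written as the minimization of a linear function of finitely many real variables subject to linear matrix inequalities and linear equations). Moreover, for any feasible solution of $(D_k^T)$ with components $(u_k,v_k,w_k)$ and for every $t\in\mathbb{R}_+$, the set $$\hat{X}_t^k:=\{x\in\mathrm{int}(X): v_k(x)+u_k t<0\}$$ is an inner approximation of $X_t$, i.e. $\hat{X}_t^k\subset X_t$. In particular, if $u_k=0$, then $\hat{X}_\infty^k:=\{x\in\mathrm{int}(X): v_k(x)<0\}$ is an inner approximation of $X_\infty$, i.e. $\hat{X}_\infty^k\subset X_\infty$.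
   Context: Setting. $f:\mathbb{R}^n\to\mathbb{R}^n$ is a polynomial vector field of degree $d_0$. $X:=\{x\in\mathbb{R}^n: g_i(x)\ge 0,\ i=1,\dots,n_X\}$ is a nonempty compact set, where $g_i$ are given real polynomials of degree $d_i$. $\mathrm{int}(X)$ is the interior of $X$ and $\partial X:=X\setminus\mathrm{int}(X)$. $\lambda$ is the Lebesgue measure on $X$. For $x_0\in\mathrm{int}(X)$, $x(\cdot|x_0)$ is the unique maximal solution of $\dot x=f(x)$ with $x(0|x_0)=x_0$. For $t\in\mathbb{R}_+$, $X_t:=\{x_0\in\mathrm{int}(X): \forall s\in[0,t],\ x(s|x_0)\in\mathrm{int}(X)\}$, and $X_\infty$ is the set of $x_0\in\mathrm{int}(X)$ such that $x(s|x_0)\in\mathrm{int}(X)$ for all $s\ge 0$ (the maximal positively invariant set included in $\mathrm{int}(X)$). $X_\infty^c:=\mathrm{int}(X)\setminus X_\infty$. For $x_0\in X_\infty^c$ the exit time is $\tau(x_0):=\inf\{t\ge 0: x(t|x_0)\notin\mathrm{int}(X)\}$, and $\overline{\tau}:=\frac{1}{\lambda(X)}\int_{X_\infty^c}\tau(x)\,dx$. Sum-of-squares problem. $\mathbb{R}_m[x]$ is the space of real polynomials in $x\in\mathbb{R}^n$ of total degree at most $m$; $\Sigma_m[x]$ is the cone of sums of squares of polynomials that have degree at most $m$. Let $k_i:=\lceil d_i/2\rceil$ for $i=0,\dots,n_X$, $\kappa:=\lceil \sum_{i=1}^{n_X}d_i/2\rceil$, $k_{min}:=\max(k_0,\kappa)$.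 For $k\ge k_{min}$ let $D:=\lceil(2k-1+d_0)/2\rceil$. For $T\in\mathbb{R}_+$, problem $(D_k^T)$ is $$d_k^T:=\inf\ \int_X w\,d\lambda+u\,T\,\lambda(X)$$ subject to the polynomial identities $$u-\nabla v\cdot f=p_0+\sum_{i=1}^{n_X}p_ig_i,\qquad w-v-1=q_0+\sum_{i=1}^{n_X}q_ig_i,$$ $$w=s_0+\sum_{i=1}^{n_X}s_ig_i,\qquad v=t_0+\sum_{i=1}^{n_X}t_ig_i+r\,g_1\cdots g_{n_X},$$ where the infimum is over $u\ge 0$, $v,w\in\mathbb{R}_{2k}[x]$, $q_0,s_0,t_0\in\Sigma_{2k}[x]$, $q_i,s_i,t_i\in\Sigma_{2(k-k_i)}[x]$ ($i=1,\dots,n_X$), $r\in\mathbb{R}_{2(k-\kappa)}[x]$, $p_0\in\Sigma_{2D}[x]$ and $p_i\in\Sigma_{2(D-k_i)}[x]$ ($i=1,\dots,n_X$). *)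

theory Defs
  imports "HOL-Analysis.Analysis" "HOL-Library.Poly_Mapping"
begin

section \<open>Real polynomials in finitely many variables\<close>

text \<open>The variables are indexed by the finite type \<open>'n\<close>. A monomial is its exponent vector, and a
  polynomial is a finitely supported family of coefficients; the ring operations are those of
  \<^theory>\<open>HOL-Library.Poly_Mapping\<close> (multiplication is convolution).\<close>

type_synonym 'n rpoly = "('n \<Rightarrow>\<^sub>0 nat) \<Rightarrow>\<^sub>0 real"

definition Const :: "real \<Rightarrow> 'n rpoly" where
  "Const c = Poly_Mapping.single 0 c"

definition Var :: "'n \<Rightarrow> 'n rpoly" where
  "Var i = Poly_Mapping.single (Poly_Mapping.single i 1) 1"

definition peval :: "'n::finite rpoly \<Rightarrow> real ^ 'n \<Rightarrow> real" where
  "peval p x = (\<Sum>m\<in>Poly_Mapping.keys p.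
      Poly_Mapping.lookup p m * (\<Prod>i\<in>UNIV. (x $ i) ^ Poly_Mapping.lookup m i))"

text \<open>Total degree; the zero polynomial has degree 0.\<close>

definition tdegree :: "'n::finite rpoly \<Rightarrow> nat" where
  "tdegree p = Max (insert 0 ((\<lambda>m. \<Sum>i\<in>UNIV. Poly_Mapping.lookup m i) ` Poly_Mapping.keys p))"

definition partial_deriv :: "'n \<Rightarrow> 'n::finite rpoly \<Rightarrow> 'n rpoly" where
  "partial_deriv i p = (\<Sum>m\<in>Poly_Mapping.keys p.
      Poly_Mapping.single (m - Poly_Mapping.single i 1)
        (real (Poly_Mapping.lookup m i) * Poly_Mapping.lookup p m))"

definition grad_dot :: "'n::finite rpoly \<Rightarrow> ('n \<Rightarrow> 'n rpoly) \<Rightarrow> 'n rpoly" where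
  "grad_dot p f = (\<Sum>i\<in>UNIV. partial_deriv i p * f i)"

definition polys_upto :: "nat \<Rightarrow> 'n::finite rpoly set" where
  "polys_upto m = {p. tdegree p \<le> m}"

definition sos_upto :: "nat \<Rightarrow> 'n::finite rpoly set" where
  "sos_upto m = {p. (\<exists>(l::nat) h. p = (\<Sum>j<l. (h j)\<^sup>2)) \<and> tdegree p \<le> m}"

definition vector_field :: "('n \<Rightarrow> 'n::finite rpoly) \<Rightarrow> real ^ 'n \<Rightarrow> real ^ 'n" where
  "vector_field f x = (\<chi> i. peval (f i) x)"

definition field_degree :: "('n \<Rightarrow> 'n::finite rpoly) \<Rightarrow> nat" where
  "field_degree f = Max (range (\<lambda>i. tdegree (f i)))"

definition semialg :: "('m \<Rightarrow> 'n::finite rpoly) \<Rightarrow> (real ^ 'n) set" where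
  "semialg g = {x. \<forall>i. 0 \<le> peval (g i) x}"


section \<open>Trajectories and invariant sets\<close>

definition ode_solution ::
  "(real ^ 'n \<Rightarrow> real ^ 'n) \<Rightarrow> real ^ 'n::finite \<Rightarrow> real set \<Rightarrow> (real \<Rightarrow> real ^ 'n) \<Rightarrow> bool" where
  "ode_solution F x0 I x \<longleftrightarrow> open I \<and> is_interval I \<and> 0 \<in> I \<and> x 0 = x0 \<and>
     (\<forall>t\<in>I. (x has_vector_derivative F (x t)) (at t))"

definition maximal_solution ::
  "(real ^ 'n \<Rightarrow> real ^ 'n) \<Rightarrow> real ^ 'n::finite \<Rightarrow> real set \<Rightarrow> (real \<Rightarrow> real ^ 'n) \<Rightarrow> bool" where
  "maximal_solution F x0 I x \<longleftrightarrow> ode_solution F x0 I x \<and>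
     (\<forall>J y. ode_solution F x0 J y \<and> I \<subseteq> J \<and> (\<forall>t\<in>I. y t = x t) \<longrightarrow> J = I)"

text \<open>For a locally Lipschitz field the maximal solution is unique up to its values outside its
  interval of existence, so the descriptions below are proper.\<close>

definition traj_dom :: "(real ^ 'n \<Rightarrow> real ^ 'n) \<Rightarrow> real ^ 'n::finite \<Rightarrow> real set" where
  "traj_dom F x0 = (THE I. \<exists>x. maximal_solution F x0 I x)"

definition traj :: "(real ^ 'n \<Rightarrow> real ^ 'n) \<Rightarrow> real ^ 'n::finite \<Rightarrow> real \<Rightarrow> real ^ 'n" where
  "traj F x0 t = (THE y. \<exists>I x. maximal_solution F x0 I x \<and> t \<in> I \<and> x t = y)"

definition inv_set :: "(real ^ 'n \<Rightarrow> real ^ 'n) \<Rightarrow> (real ^ 'n::finite) set \<Rightarrow> real \<Rightarrow> (real ^ 'n) set" where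
  "inv_set F X t = {x0 \<in> interior X. \<forall>s\<in>{0..t}. s \<in> traj_dom F x0 \<and> traj F x0 s \<in> interior X}"

definition inv_set_infinity :: "(real ^ 'n \<Rightarrow> real ^ 'n) \<Rightarrow> (real ^ 'n::finite) set \<Rightarrow> (real ^ 'n) set" where
  "inv_set_infinity F X =
     {x0 \<in> interior X. \<forall>s\<ge>0. s \<in> traj_dom F x0 \<and> traj F x0 s \<in> interior X}"

definition exit_time :: "(real ^ 'n \<Rightarrow> real ^ 'n) \<Rightarrow> (real ^ 'n::finite) set \<Rightarrow> real ^ 'n \<Rightarrow> real" where
  "exit_time F X x0 = Inf {t. 0 \<le> t \<and> t \<in> traj_dom F x0 \<and> traj F x0 t \<notin> interior X}"

definition mean_exit_time :: "(real ^ 'n \<Rightarrow> real ^ 'n) \<Rightarrow> (real ^ 'n::finite) set \<Rightarrow> ennreal" where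
  "mean_exit_time F X =
     (\<integral>\<^sup>+x. ennreal (exit_time F X x) * indicator (interior X - inv_set_infinity F X) x \<partial>lebesgue)
       / emeasure lebesgue X"

definition lyapunov_stable_equilibrium ::
  "(real ^ 'n \<Rightarrow> real ^ 'n) \<Rightarrow> real ^ 'n::finite \<Rightarrow> bool" where
  "lyapunov_stable_equilibrium F e \<longleftrightarrow> F e = 0 \<and>
     (\<forall>\<epsilon>>0. \<exists>\<delta>>0. \<forall>x0. dist x0 e < \<delta> \<longrightarrow>
        (\<forall>t\<ge>0. t \<in> traj_dom F x0 \<and> dist (traj F x0 t) e < \<epsilon>))"


section \<open>The sum-of-squares problem\<close>

text \<open>The constraints are indexed by the finite type \<open>'m\<close>. In each certificate
  \<open>p\<^sub>0 + \<Sum>\<^sub>i p\<^sub>i g\<^sub>i\<close> the multiplier \<open>p\<^sub>0\<close> is a separate component.\<close>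

record ('n, 'm) sos_vars =
  sol_u :: real
  sol_v :: "'n rpoly"
  sol_w :: "'n rpoly"
  sol_p0 :: "'n rpoly"
  sol_p :: "'m \<Rightarrow> 'n rpoly"
  sol_q0 :: "'n rpoly"
  sol_q :: "'m \<Rightarrow> 'n rpoly"
  sol_s0 :: "'n rpoly"
  sol_s :: "'m \<Rightarrow> 'n rpoly"
  sol_t0 :: "'n rpoly"
  sol_t :: "'m \<Rightarrow> 'n rpoly"
  sol_r :: "'n rpoly"

definition half_deg :: "nat \<Rightarrow> nat" where
  "half_deg d = nat \<lceil>real d / 2\<rceil>"

definition kappa :: "('m::finite \<Rightarrow> 'n::finite rpoly) \<Rightarrow> nat" where
  "kappa g = nat \<lceil>real (\<Sum>i\<in>UNIV. tdegree (g i)) / 2\<rceil>"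

definition k_min :: "('n \<Rightarrow> 'n rpoly) \<Rightarrow> ('m::finite \<Rightarrow> 'n::finite rpoly) \<Rightarrow> nat" where
  "k_min f g = max (half_deg (field_degree f)) (kappa g)"

definition D_order :: "('n \<Rightarrow> 'n::finite rpoly) \<Rightarrow> nat \<Rightarrow> nat" where
  "D_order f k = nat \<lceil>(2 * real k - 1 + real (field_degree f)) / 2\<rceil>"

definition sos_feasible ::
  "('n \<Rightarrow> 'n rpoly) \<Rightarrow> ('m::finite \<Rightarrow> 'n::finite rpoly) \<Rightarrow> nat \<Rightarrow> ('n, 'm) sos_vars set" where
  "sos_feasible f g k = {z.
     0 \<le> sol_u z \<and>
     sol_v z \<in> polys_upto (2 * k) \<and> sol_w z \<in> polys_upto (2 * k) \<and>
     sol_q0 z \<in> sos_upto (2 * k) \<and> sol_s0 z \<in> sos_upto (2 * k) \<and> sol_t0 z \<in> sos_upto (2 * k) \<and>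
     (\<forall>i. sol_q z i \<in> sos_upto (2 * (k - half_deg (tdegree (g i)))) \<and>
          sol_s z i \<in> sos_upto (2 * (k - half_deg (tdegree (g i)))) \<and>
          sol_t z i \<in> sos_upto (2 * (k - half_deg (tdegree (g i))))) \<and>
     sol_r z \<in> polys_upto (2 * (k - kappa g)) \<and>
     sol_p0 z \<in> sos_upto (2 * D_order f k) \<and>
     (\<forall>i. sol_p z i \<in> sos_upto (2 * (D_order f k - half_deg (tdegree (g i))))) \<and>
     Const (sol_u z) - grad_dot (sol_v z) f = sol_p0 z + (\<Sum>i\<in>UNIV. sol_p z i * g i) \<and>
     sol_w z - sol_v z - 1 = sol_q0 z + (\<Sum>i\<in>UNIV. sol_q z i * g i) \<and>
     sol_w z = sol_s0 z + (\<Sum>i\<in>UNIV. sol_s z i * g i) \<and>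
     sol_v z = sol_t0 z + (\<Sum>i\<in>UNIV. sol_t z i * g i) + sol_r z * (\<Prod>i\<in>UNIV. g i)}"

definition sos_objective ::
  "('m::finite \<Rightarrow> 'n::finite rpoly) \<Rightarrow> real \<Rightarrow> ('n, 'm) sos_vars \<Rightarrow> real" where
  "sos_objective g T z =
     (LINT x:semialg g|lebesgue. peval (sol_w z) x) + sol_u z * T * measure lebesgue (semialg g)"


section \<open>LMI problems\<close>

text \<open>Square matrices of variable size \<open>m\<close> are functions of two indices below \<open>m\<close>.\<close>

definition sym_matrix :: "nat \<Rightarrow> (nat \<Rightarrow> nat \<Rightarrow> real) \<Rightarrow> bool" where
  "sym_matrix m A \<longleftrightarrow> (\<forall>a<m. \<forall>b<m. A a b = A b a)"

definition psd_matrix :: "nat \<Rightarrow> (nat \<Rightarrow> nat \<Rightarrow> real) \<Rightarrow> bool" where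
  "psd_matrix m A \<longleftrightarrow> sym_matrix m A \<and> (\<forall>x::nat \<Rightarrow> real. 0 \<le> (\<Sum>a<m. \<Sum>b<m. A a b * x a * x b))"

text \<open>An LMI block \<open>(m, A)\<close> stands for \<open>A 0 + (\<Sum>j<N. y j * A (Suc j)) \<succeq> 0\<close> with \<open>m \<times> m\<close> matrices,
  where \<open>N\<close> is the number of variables; an equation \<open>(a, c)\<close> stands for \<open>(\<Sum>j<N. a j * y j) = c\<close>.\<close>

record lmi_program =
  lmi_nvars :: nat
  lmi_cost :: "nat \<Rightarrow> real"
  lmi_blocks :: "(nat \<times> (nat \<Rightarrow> nat \<Rightarrow> nat \<Rightarrow> real)) list"
  lmi_eqs :: "((nat \<Rightarrow> real) \<times> real) list"

definition lmi_wf :: "lmi_program \<Rightarrow> bool" where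
  "lmi_wf P \<longleftrightarrow> (\<forall>(m, A)\<in>set (lmi_blocks P). \<forall>j\<le>lmi_nvars P. sym_matrix m (A j))"

definition lmi_feasible :: "lmi_program \<Rightarrow> (nat \<Rightarrow> real) set" where
  "lmi_feasible P = {y.
     (\<forall>j\<ge>lmi_nvars P. y j = 0) \<and>
     (\<forall>(m, A)\<in>set (lmi_blocks P).
        psd_matrix m (\<lambda>a b. A 0 a b + (\<Sum>j<lmi_nvars P. y j * A (Suc j) a b))) \<and>
     (\<forall>(a, c)\<in>set (lmi_eqs P). (\<Sum>j<lmi_nvars P. a j * y j) = c)}"

definition lmi_objective :: "lmi_program \<Rightarrow> (nat \<Rightarrow> real) \<Rightarrow> real" where
  "lmi_objective P y = (\<Sum>j<lmi_nvars P. lmi_cost P j * y j)"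

text \<open>The linear combination \<open>\<Sum>j<N. y j * B j\<close>, componentwise.\<close>

definition lin_comb ::
  "nat \<Rightarrow> (nat \<Rightarrow> ('n, 'm) sos_vars) \<Rightarrow> (nat \<Rightarrow> real) \<Rightarrow> ('n::finite, 'm) sos_vars" where
  "lin_comb N B y = \<lparr>
     sol_u = (\<Sum>j<N. y j * sol_u (B j)),
     sol_v = (\<Sum>j<N. Const (y j) * sol_v (B j)),
     sol_w = (\<Sum>j<N. Const (y j) * sol_w (B j)),
     sol_p0 = (\<Sum>j<N. Const (y j) * sol_p0 (B j)),
     sol_p = (\<lambda>i. \<Sum>j<N. Const (y j) * sol_p (B j) i),
     sol_q0 = (\<Sum>j<N. Const (y j) * sol_q0 (B j)),
     sol_q = (\<lambda>i. \<Sum>j<N. Const (y j) * sol_q (B j) i),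
     sol_s0 = (\<Sum>j<N. Const (y j) * sol_s0 (B j)),
     sol_s = (\<lambda>i. \<Sum>j<N. Const (y j) * sol_s (B j) i),
     sol_t0 = (\<Sum>j<N. Const (y j) * sol_t0 (B j)),
     sol_t = (\<lambda>i. \<Sum>j<N. Const (y j) * sol_t (B j) i),
     sol_r = (\<Sum>j<N. Const (y j) * sol_r (B j)) \<rparr>"

text \<open>Minimizing \<open>J\<close> over \<open>S\<close> is an LMI problem if a linear change of variables maps the feasible set
  of an LMI program onto \<open>S\<close> and turns \<open>J\<close> into the linear cost. The change of variables need not be
  injective: the Gram matrix of a sum of squares is not unique.\<close>

definition is_lmi_problem :: "('n::finite, 'm) sos_vars set \<Rightarrow> (('n, 'm) sos_vars \<Rightarrow> real) \<Rightarrow> bool" where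
  "is_lmi_problem S J \<longleftrightarrow> (\<exists>P B. lmi_wf P \<and>
     lin_comb (lmi_nvars P) B ` lmi_feasible P = S \<and>
     (\<forall>y\<in>lmi_feasible P. J (lin_comb (lmi_nvars P) B y) = lmi_objective P y))"

end

theory Submission
  imports Defs
begin

text \<open>The two claims are independent of each other.

  Inner approximation. Let \<open>x0\<close> be an interior point of the compact set \<open>X\<close> with
  \<open>v x0 + u * t < 0\<close>. The first certificate says that \<open>\<nabla>v \<sqdot> f \<le> u\<close> on \<open>X\<close>, so as long as the
  trajectory from \<open>x0\<close> is in \<open>X\<close>, at time \<open>s\<close> it satisfies \<open>v \<le> v x0 + u * s\<close>, which is negative for
  \<open>s \<le> t\<close>. On the boundary of \<open>X\<close> the product of the \<open>g i\<close> vanishes (\<open>prod_eq_0_on_boundary\<close>), and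
  the last certificate gives \<open>v \<ge> 0\<close>. Hence the boundary is not reached before time \<open>t\<close>
  (\<open>inner_approximation\<close>). The case \<open>u = 0\<close> applies to every \<open>t\<close> at once. Behind this stands the
  theory of maximal solutions: a bounded, globally Lipschitz field has a global solution
  (\<open>global_solution\<close>), solutions are unique (\<open>ode_solution_unique\<close>), and the maximal solution extends
  all others (\<open>traj_eq_solution\<close>). It suffices to solve the equation with the field modified
  outside a ball that contains \<open>X\<close> (\<open>stays_in_interior\<close>).

  LMI problem. A polynomial of degree at most \<open>2d\<close> is a sum of squares if and only if it is
  \<open>\<Sum>a b. Y a b * x^(m a + m b)\<close> for a positive semidefinite matrix \<open>Y\<close>, where the \<open>m a\<close> are the
  exponent vectors of degree at most \<open>d\<close> (\<open>sos_upto_iff_gram\<close>). In one direction, the summands \<open>h\<close> of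
  a sum of squares \<open>\<Sum> h\<^sup>2\<close> of degree at most \<open>2d\<close> have degree at most \<open>d\<close>, because leading terms
  do not cancel (\<open>sum_squares_degree\<close>); the other direction is the Cholesky factorization of \<open>Y\<close>
  (\<open>psd_matrix_factorization\<close>). So each unknown of the problem ranges over a linear image of the
  feasible set of an LMI program. Such images are closed under Minkowski sums (\<open>lmi_rep_add\<close>), hence
  under products of the ranges of separate unknowns, and under intersection with the solution set of
  a linear polynomial equation (\<open>lmi_rep_equation\<close>). The objective is linear because polynomials are
  integrable over the compact set \<open>X\<close>.\<close>

section \<open>Evaluation and differentiation of polynomials\<close>

text \<open>The monomial with exponent vector \<open>m\<close>.\<close>
abbreviation monomial :: "('n \<Rightarrow>\<^sub>0 nat) \<Rightarrow> 'n rpoly" where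
  "monomial m \<equiv> Poly_Mapping.single m 1"

lemma poly_as_sum:
  fixes p :: "'n rpoly"
  assumes "finite K" "Poly_Mapping.keys p \<subseteq> K"
  shows "p = (\<Sum>m\<in>K. Poly_Mapping.single m (Poly_Mapping.lookup p m))"
proof (rule poly_mapping_eqI)
  fix k
  have "(\<Sum>m\<in>K. Poly_Mapping.lookup p m when m = k) =
      (\<Sum>m\<in>K. if k = m then Poly_Mapping.lookup p m else 0)"
    by (intro sum.cong) (auto simp: when_def)
  also have "\<dots> = Poly_Mapping.lookup p k"
    using assms by (auto simp: in_keys_iff subset_iff)
  finally show "Poly_Mapping.lookup p k =
      Poly_Mapping.lookup (\<Sum>m\<in>K. Poly_Mapping.single m (Poly_Mapping.lookup p m)) k"
    by (simp add: lookup_sum lookup_single)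
qed

lemma lookup_Const_mult [simp]:
  "Poly_Mapping.lookup (Const a * p) m = a * Poly_Mapping.lookup p m"
  unfolding Const_def mult_map_scale_conv_mult[symmetric]
  by (simp add: Poly_Mapping.map.rep_eq when_def)

lemma Const_0 [simp]: "Const 0 = 0"
  by (simp add: Const_def)

lemma Const_add: "Const (a + b) = Const a + Const b"
  by (simp add: Const_def single_add)

lemma Const_mult: "Const (a * b) = Const a * Const b"
  by (simp add: Const_def mult_single)

lemma Const_sum: "Const (\<Sum>i\<in>A. c i) = (\<Sum>i\<in>A. Const (c i))"
  by (induction A rule: infinite_finite_induct) (auto simp: Const_add)

lemma single_eq_Const_mult: "Poly_Mapping.single m c = Const c * monomial m"
  by (simp add: Const_def mult_single)

lemma peval_superset:
  assumes "finite K" "Poly_Mapping.keys p \<subseteq> K"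
  shows "peval p x = (\<Sum>m\<in>K. Poly_Mapping.lookup p m * (\<Prod>i\<in>UNIV. (x $ i) ^ Poly_Mapping.lookup m i))"
  unfolding peval_def using assms by (intro sum.mono_neutral_left) (auto simp: in_keys_iff)

lemma peval_0 [simp]: "peval 0 x = 0"
  by (simp add: peval_def)

lemma peval_single [simp]:
  "peval (Poly_Mapping.single m c) x = c * (\<Prod>i\<in>UNIV. (x $ i) ^ Poly_Mapping.lookup m i)"
  by (subst peval_superset[of "{m}"]) (auto split: if_splits)

lemma peval_add [simp]: "peval (p + q) x = peval p x + peval q x"
proof -
  let ?K = "Poly_Mapping.keys p \<union> Poly_Mapping.keys q"
  have "Poly_Mapping.keys (p + q) \<subseteq> ?K"
    by (rule keys_add)
  then show ?thesis
    by (simp add: peval_superset[of ?K] lookup_add algebra_simps sum.distrib)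
qed

lemma peval_sum [simp]: "peval (\<Sum>i\<in>A. h i) x = (\<Sum>i\<in>A. peval (h i) x)"
  by (induction A rule: infinite_finite_induct) auto

lemma peval_minus [simp]: "peval (p - q) x = peval p x - peval q x"
  using peval_add[of "p - q" q x] by simp

lemma peval_mult [simp]: "peval (p * q) x = peval p x * peval q x"
proof -
  let ?c = Poly_Mapping.lookup and ?k = Poly_Mapping.keys
  let ?mon = "\<lambda>m. \<Prod>i\<in>UNIV. (x $ i) ^ Poly_Mapping.lookup m i"
  have "p * q = (\<Sum>a\<in>?k p. Poly_Mapping.single a (?c p a)) * (\<Sum>b\<in>?k q. Poly_Mapping.single b (?c q b))"
    using poly_as_sum[of "?k p" p] poly_as_sum[of "?k q" q] by simp
  also have "\<dots> = (\<Sum>a\<in>?k p. \<Sum>b\<in>?k q. Poly_Mapping.single (a + b) (?c p a * ?c q b))"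
    by (simp add: sum_product mult_single)
  finally have "peval (p * q) x = (\<Sum>a\<in>?k p. \<Sum>b\<in>?k q. (?c p a * ?mon a) * (?c q b * ?mon b))"
    by (simp add: lookup_add power_add prod.distrib mult_ac)
  then show ?thesis
    by (simp add: peval_def sum_product)
qed

lemma peval_Const [simp]: "peval (Const c) x = c"
  by (simp add: Const_def)

lemma peval_1 [simp]: "peval 1 x = 1"
  using peval_single[of 0 1 x] by simp

lemma peval_power [simp]: "peval (p ^ n) x = peval p x ^ n"
  by (induction n) auto

lemma peval_prod [simp]: "peval (\<Prod>i\<in>A. h i) x = (\<Prod>i\<in>A. peval (h i) x)"
  by (induction A rule: infinite_finite_induct) auto

lemma partial_deriv_superset:
  assumes "finite K" "Poly_Mapping.keys p \<subseteq> K"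
  shows "partial_deriv i p = (\<Sum>m\<in>K. Poly_Mapping.single (m - Poly_Mapping.single i 1)
        (real (Poly_Mapping.lookup m i) * Poly_Mapping.lookup p m))"
  unfolding partial_deriv_def using assms
  by (intro sum.mono_neutral_left) (auto simp: in_keys_iff)

lemma partial_deriv_add: "partial_deriv i (p + q) = partial_deriv i p + partial_deriv i q"
proof -
  let ?K = "Poly_Mapping.keys p \<union> Poly_Mapping.keys q"
  have "Poly_Mapping.keys (p + q) \<subseteq> ?K"
    by (rule keys_add)
  then show ?thesis
    by (simp add: partial_deriv_superset[of ?K] lookup_add algebra_simps sum.distrib single_add)
qed

lemma partial_deriv_Const_mult: "partial_deriv i (Const a * p) = Const a * partial_deriv i p"
proof -
  have "Poly_Mapping.keys (Const a * p) \<subseteq> Poly_Mapping.keys p"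
    by (auto simp: in_keys_iff)
  then show ?thesis
    by (simp add: partial_deriv_superset[of "Poly_Mapping.keys p"] sum_distrib_left
        single_eq_Const_mult[of _ "_ * _"] Const_mult mult.assoc mult.left_commute)
qed

lemma grad_dot_add: "grad_dot (p + q) f = grad_dot p f + grad_dot q f"
  by (simp add: grad_dot_def partial_deriv_add algebra_simps sum.distrib)

lemma grad_dot_Const_mult: "grad_dot (Const a * p) f = Const a * grad_dot p f"
  by (simp add: grad_dot_def partial_deriv_Const_mult sum_distrib_left mult.assoc)

lemma has_derivative_monomial:
  fixes x :: "real ^ 'n::finite"
  shows "((\<lambda>x. \<Prod>i\<in>UNIV. (x $ i) ^ Poly_Mapping.lookup m i) has_derivative
    (\<lambda>h. \<Sum>i\<in>UNIV. real (Poly_Mapping.lookup m i) *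
        (\<Prod>j\<in>UNIV. (x $ j) ^ Poly_Mapping.lookup (m - Poly_Mapping.single i 1) j) * h $ i)) (at x)"
proof -
  let ?c = "Poly_Mapping.lookup m"
  have *: "(\<Prod>j\<in>UNIV. (x $ j) ^ Poly_Mapping.lookup (m - Poly_Mapping.single i 1) j)
      = (x $ i) ^ (?c i - 1) * (\<Prod>j\<in>UNIV - {i}. (x $ j) ^ ?c j)" for i
    by (subst prod.remove[of _ i])
      (auto simp: lookup_minus lookup_single when_def intro!: prod.cong)
  have "((\<lambda>x. \<Prod>i\<in>UNIV. (x $ i) ^ ?c i) has_derivative
      (\<lambda>h. \<Sum>i\<in>UNIV. (real (?c i) * h $ i * (x $ i) ^ (?c i - 1)) * (\<Prod>j\<in>UNIV - {i}. (x $ j) ^ ?c j))) (at x)"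
    by (intro has_derivative_prod has_derivative_power bounded_linear.has_derivative[OF bounded_linear_vec_nth]
        has_derivative_ident)
  then show ?thesis
    unfolding * by (simp add: mult_ac)
qed

lemma has_derivative_peval:
  fixes x :: "real ^ 'n::finite"
  shows "(peval p has_derivative (\<lambda>h. \<Sum>i\<in>UNIV. peval (partial_deriv i p) x * h $ i)) (at x)"
proof -
  have "((\<lambda>x. \<Sum>m\<in>Poly_Mapping.keys p. Poly_Mapping.lookup p m * (\<Prod>i\<in>UNIV. (x $ i) ^ Poly_Mapping.lookup m i))
      has_derivative (\<lambda>h. \<Sum>m\<in>Poly_Mapping.keys p. Poly_Mapping.lookup p m *
        (\<Sum>i\<in>UNIV. real (Poly_Mapping.lookup m i) *
        (\<Prod>j\<in>UNIV. (x $ j) ^ Poly_Mapping.lookup (m - Poly_Mapping.single i 1) j) * h $ i))) (at x)"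
    by (intro has_derivative_sum has_derivative_mult_right has_derivative_monomial)
  also have "(\<lambda>h. \<Sum>m\<in>Poly_Mapping.keys p. Poly_Mapping.lookup p m *
        (\<Sum>i\<in>UNIV. real (Poly_Mapping.lookup m i) *
        (\<Prod>j\<in>UNIV. (x $ j) ^ Poly_Mapping.lookup (m - Poly_Mapping.single i 1) j) * h $ i))
     = (\<lambda>h. \<Sum>i\<in>UNIV. peval (partial_deriv i p) x * h $ i)"
    unfolding partial_deriv_def sum_distrib_left
    by (subst sum.swap) (simp add: sum_distrib_left sum_distrib_right mult_ac fun_eq_iff)
  finally show ?thesis
    by (simp add: peval_def[abs_def])
qed

lemma continuous_on_peval [continuous_intros]: "continuous_on A (peval p)"
  by (intro continuous_at_imp_continuous_on ballI has_derivative_continuous[OF has_derivative_peval])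

lemma peval_deriv_along_solution:
  assumes "(y has_vector_derivative vector_field f (y s)) (at s within A)"
  shows "((\<lambda>s. peval p (y s)) has_real_derivative peval (grad_dot p f) (y s)) (at s within A)"
  using has_derivative_compose[OF assms[unfolded has_vector_derivative_def] has_derivative_peval[of p "y s"]]
  unfolding has_field_derivative_def
  by (rule has_derivative_eq_rhs)
    (simp add: grad_dot_def vector_field_def sum_distrib_left mult_ac fun_eq_iff)

section \<open>Degrees and sums of squares\<close>

text \<open>The total degree of the monomial with exponent vector \<open>m\<close>.\<close>
abbreviation mdeg :: "('n::finite \<Rightarrow>\<^sub>0 nat) \<Rightarrow> nat" where
  "mdeg m \<equiv> (\<Sum>i\<in>UNIV. Poly_Mapping.lookup m i)"

lemma tdegree_le_iff: "tdegree p \<le> d \<longleftrightarrow> (\<forall>m\<in>Poly_Mapping.keys p. mdeg m \<le> d)"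
  by (auto simp: tdegree_def)

lemma finite_mdeg_le: "finite {m :: 'n::finite \<Rightarrow>\<^sub>0 nat. mdeg m \<le> d}"
proof (rule finite_imageD)
  have "Poly_Mapping.lookup ` {m :: 'n \<Rightarrow>\<^sub>0 nat. mdeg m \<le> d} \<subseteq> PiE UNIV (\<lambda>_. {..d})"
  proof safe
    fix m :: "'n \<Rightarrow>\<^sub>0 nat" and i
    assume "mdeg m \<le> d"
    moreover have "Poly_Mapping.lookup m i \<le> mdeg m"
      by (rule member_le_sum) auto
    ultimately show "Poly_Mapping.lookup m i \<le> d"
      by simp
  qed auto
  then show "finite (Poly_Mapping.lookup ` {m :: 'n \<Rightarrow>\<^sub>0 nat. mdeg m \<le> d})"
    by (rule finite_subset) (auto intro: finite_PiE)
  show "inj_on Poly_Mapping.lookup {m :: 'n \<Rightarrow>\<^sub>0 nat. mdeg m \<le> d}"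
    by (auto intro!: inj_onI poly_mapping_eqI)
qed

lemma mdeg_add [simp]: "mdeg (a + b) = mdeg a + mdeg b"
  by (simp add: lookup_add sum.distrib)

text \<open>If \<open>2M\<close> arises from exponents of \<open>h\<close> only as \<open>M + M\<close>, no mixed products contribute to its
  coefficient in the square.\<close>
lemma lookup_square_extreme:
  fixes h :: "'n rpoly"
  assumes "\<And>a b. a \<in> Poly_Mapping.keys h \<Longrightarrow> b \<in> Poly_Mapping.keys h \<Longrightarrow> a + b = M + M \<Longrightarrow> a = M \<and> b = M"
  shows "Poly_Mapping.lookup (h\<^sup>2) (M + M) = (Poly_Mapping.lookup h M)\<^sup>2"
proof -
  let ?c = "Poly_Mapping.lookup h" and ?k = "Poly_Mapping.keys h"
  have "h\<^sup>2 = (\<Sum>a\<in>?k. Poly_Mapping.single a (?c a)) * (\<Sum>b\<in>?k. Poly_Mapping.single b (?c b))"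
    using poly_as_sum[of ?k h] by (simp add: power2_eq_square)
  also have "\<dots> = (\<Sum>a\<in>?k. \<Sum>b\<in>?k. Poly_Mapping.single (a + b) (?c a * ?c b))"
    by (simp add: sum_product mult_single)
  finally have "Poly_Mapping.lookup (h\<^sup>2) (M + M) =
      (\<Sum>a\<in>?k. \<Sum>b\<in>?k. ?c a * ?c b when a + b = M + M)"
    by (simp add: lookup_sum lookup_single)
  also have "\<dots> = (\<Sum>a\<in>?k. \<Sum>b\<in>?k. if b = M then (if a = M then ?c a * ?c b else 0) else 0)"
  proof (intro sum.cong refl)
    fix a b
    assume "a \<in> ?k" "b \<in> ?k"
    then have "a + b = M + M \<longleftrightarrow> b = M \<and> a = M"
      using assms by blast
    then show "(?c a * ?c b when a + b = M + M) = (if b = M then if a = M then ?c a * ?c b else 0 else 0)"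
      by (simp add: when_def)
  qed
  also have "\<dots> = (?c M)\<^sup>2"
    by (cases "?c M = 0") (auto simp: in_keys_iff power2_eq_square)
  finally show ?thesis .
qed

text \<open>Leading terms of squares cannot cancel. Among the monomials of maximal degree that occur in
  the \<open>h j\<close>, take an exponent vector \<open>M\<close> of maximal Euclidean length. By the parallelogram law \<open>2M\<close>
  is the sum of two occurring exponents only as \<open>M + M\<close>, so its coefficient in the sum of squares is
  a sum of squares of real numbers that do not all vanish.\<close>
lemma sum_squares_degree:
  fixes h :: "nat \<Rightarrow> 'n::finite rpoly"
  assumes deg: "tdegree (\<Sum>j<l. (h j)\<^sup>2) \<le> 2 * d" and j: "j < l"
  shows "tdegree (h j) \<le> d"
proof (rule ccontr)
  assume contra: "\<not> tdegree (h j) \<le> d"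
  define K where "K = (\<Union>j<l. Poly_Mapping.keys (h j))"
  have finK: "finite K"
    by (simp add: K_def)
  from contra obtain m0 where m0: "m0 \<in> K" "mdeg m0 > d"
    using j by (auto simp: tdegree_le_iff K_def not_le)
  define e where "e = Max (mdeg ` K)"
  have e_le: "mdeg m \<le> e" if "m \<in> K" for m
    using that finK by (simp add: e_def)
  have "e \<in> mdeg ` K"
    unfolding e_def using m0 finK by (intro Max_in) auto
  then have ne: "{m\<in>K. mdeg m = e} \<noteq> {}"
    by auto
  define sq where "sq = (\<lambda>m :: 'n \<Rightarrow>\<^sub>0 nat. \<Sum>i\<in>UNIV. (real (Poly_Mapping.lookup m i))\<^sup>2)"
  have "\<exists>M\<in>{m\<in>K. mdeg m = e}. \<forall>m\<in>{m\<in>K. mdeg m = e}. sq m \<le> sq M"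
  proof -
    let ?S = "{m\<in>K. mdeg m = e}"
    have "Max (sq ` ?S) \<in> sq ` ?S"
      using ne finK by (intro Max_in) auto
    then obtain M where "M \<in> ?S" "sq M = Max (sq ` ?S)"
      by (metis (no_types, lifting) imageE)
    then show ?thesis
      using finK by (intro bexI[of _ M]) auto
  qed
  then obtain M where M: "M \<in> K" "mdeg M = e"
    and Mmax: "\<And>m. m \<in> K \<Longrightarrow> mdeg m = e \<Longrightarrow> sq m \<le> sq M"
    by blast
  have extreme: "a = M \<and> b = M" if "a \<in> K" "b \<in> K" and ab: "a + b = M + M" for a b
  proof -
    have "mdeg a + mdeg b = e + e"
      using arg_cong[OF ab, of mdeg] M by simp
    with e_le[OF that(1)] e_le[OF that(2)] have ab_deg: "mdeg a = e" "mdeg b = e"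
      by linarith+
    have cab: "real (Poly_Mapping.lookup b i) = 2 * real (Poly_Mapping.lookup M i) - real (Poly_Mapping.lookup a i)" for i
    proof -
      have "Poly_Mapping.lookup a i + Poly_Mapping.lookup b i = Poly_Mapping.lookup M i + Poly_Mapping.lookup M i"
        using arg_cong[OF ab, of "\<lambda>m. Poly_Mapping.lookup m i"] by (simp add: lookup_add)
      then show ?thesis
        by linarith
    qed
    have "sq a + sq b = 2 * sq M + 2 * (\<Sum>i\<in>UNIV. (real (Poly_Mapping.lookup a i) - real (Poly_Mapping.lookup M i))\<^sup>2)"
      unfolding sq_def cab sum_distrib_left sum.distrib[symmetric]
      by (intro sum.cong) (auto simp: power2_eq_square algebra_simps)
    moreover have "sq a \<le> sq M" "sq b \<le> sq M"
      using Mmax that ab_deg by auto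
    ultimately have "(\<Sum>i\<in>UNIV. (real (Poly_Mapping.lookup a i) - real (Poly_Mapping.lookup M i))\<^sup>2) \<le> 0"
      by linarith
    then have "(\<Sum>i\<in>UNIV. (real (Poly_Mapping.lookup a i) - real (Poly_Mapping.lookup M i))\<^sup>2) = 0"
      by (intro antisym sum_nonneg) auto
    then have "Poly_Mapping.lookup a i = Poly_Mapping.lookup M i" for i
      by (simp add: sum_nonneg_eq_0_iff)
    then have "a = M"
      by (rule poly_mapping_eqI)
    with ab show ?thesis
      by simp
  qed
  let ?p = "\<Sum>j<l. (h j)\<^sup>2"
  have "Poly_Mapping.lookup ?p (M + M) = (\<Sum>j<l. (Poly_Mapping.lookup (h j) M)\<^sup>2)"
    unfolding lookup_sum
    by (intro sum.cong refl lookup_square_extreme extreme) (auto simp: K_def)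
  also have "\<dots> > 0"
  proof -
    obtain i where "i < l" "M \<in> Poly_Mapping.keys (h i)"
      using M by (auto simp: K_def)
    then show ?thesis
      by (intro sum_pos2[of _ i]) (auto simp: in_keys_iff)
  qed
  finally have "M + M \<in> Poly_Mapping.keys ?p"
    by (simp add: in_keys_iff)
  then have "mdeg (M + M) \<le> 2 * d"
    using deg tdegree_le_iff by blast
  moreover have "e > d"
    using e_le[OF m0(1)] m0(2) by simp
  ultimately show False
    using M by simp
qed

lemma sos_upto_nonneg: "p \<in> sos_upto d \<Longrightarrow> 0 \<le> peval p x"
  by (auto simp: sos_upto_def intro!: sum_nonneg)

section \<open>Solutions of autonomous differential equations\<close>

text \<open>An exponentially growing integrand has a primitive of the same growth, with a constant smaller
  by the factor \<open>K\<close>. This gain is what makes the integral operator below a contraction.\<close>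
lemma primitive_exp_bound_forward:
  fixes P :: "real \<Rightarrow> 'a::euclidean_space"
  assumes P: "\<And>s. (P has_vector_derivative h s) (at s)" "P 0 = 0"
    and h: "\<And>s. norm (h s) \<le> C * exp (K * \<bar>s\<bar>)" and K: "K > 0" and t: "t \<ge> 0"
  shows "norm (P t) \<le> C / K * exp (K * t)"
proof -
  have C: "C \<ge> 0"
    using h[of 0] order_trans[OF norm_ge_zero] by fastforce
  have "norm (P t - P 0) \<le> C / K * exp (K * t) - C / K * exp (K * 0)" if "t > 0"
  proof (rule differentiable_bound_general[OF that])
    show "continuous_on {0..t} P"
      using P(1) by (intro continuous_at_imp_continuous_on) (blast intro: has_vector_derivative_continuous)
    show "continuous_on {0..t} (\<lambda>s. C / K * exp (K * s))"
      by (intro continuous_intros)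
    show "(P has_vector_derivative h s) (at s)" for s
      by (rule P)
    show "((\<lambda>s. C / K * exp (K * s)) has_vector_derivative C * exp (K * s)) (at s)" for s
      unfolding has_real_derivative_iff_has_vector_derivative[symmetric]
      using K by (auto intro!: derivative_eq_intros)
    show "norm (h s) \<le> C * exp (K * s)" if "0 < s" for s
      using h[of s] that by simp
  qed
  then have "norm (P t) \<le> C / K * exp (K * t) - C / K" if "t > 0"
    using that P(2) by simp
  moreover have "C / K \<ge> 0"
    using C K by simp
  ultimately show ?thesis
    using t P(2) by (cases "t = 0") auto
qed

lemma has_vector_derivative_reflect:
  assumes "(y has_vector_derivative D) (at (- t))"
  shows "((\<lambda>s. y (- s)) has_vector_derivative - D) (at (t::real))"
proof -
  have "((y \<circ> uminus) has_vector_derivative (- 1) *\<^sub>R D) (at t)"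
    by (rule vector_diff_chain_at) (use assms in \<open>auto intro!: derivative_eq_intros\<close>)
  then show ?thesis
    by (simp add: o_def)
qed

lemma primitive_exp_bound:
  fixes P :: "real \<Rightarrow> 'a::euclidean_space"
  assumes P: "\<And>s. (P has_vector_derivative h s) (at s)" "P 0 = 0"
    and h: "\<And>s. norm (h s) \<le> C * exp (K * \<bar>s\<bar>)" and K: "K > 0"
  shows "norm (P t) \<le> C / K * exp (K * \<bar>t\<bar>)"
proof (cases "t \<ge> 0")
  case True
  then show ?thesis
    using primitive_exp_bound_forward[OF P h K True] by simp
next
  case False
  have "norm (P (- (- t))) \<le> C / K * exp (K * (- t))"
    by (rule primitive_exp_bound_forward[of "\<lambda>s. P (- s)" "\<lambda>s. - h (- s)" C K "- t"])
      (use P h K False in \<open>auto intro!: has_vector_derivative_reflect simp: norm_minus_cancel\<close>,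
        metis abs_minus_cancel)
  then show ?thesis
    using False by simp
qed

text \<open>The theorem of Picard and Lindeloef for a bounded, globally Lipschitz field. The substitution
  \<open>y t = x0 + exp (K * \<bar>t\<bar>) *\<^sub>R z t\<close> with \<open>K\<close> larger than twice the Lipschitz constant turns the
  integral equation into a fixed-point problem for a contraction of the bounded continuous functions
  on the whole line, so that no local solutions have to be glued together.\<close>
lemma global_solution:
  fixes G :: "'a::euclidean_space \<Rightarrow> 'a"
  assumes lip: "L-lipschitz_on UNIV G" and bnd: "\<And>x. norm (G x) \<le> M"
  obtains y where "y 0 = x0" "\<And>t. (y has_vector_derivative G (y t)) (at t)"
proof -
  define K where "K = 2 * L + 1"
  have L: "L \<ge> 0"
    using lip lipschitz_on_nonneg by blast
  have K: "K > 0" "L / K \<le> 1 / 2"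
    using L by (auto simp: K_def divide_simps)
  have M: "M \<ge> 0"
    using bnd[of 0] norm_ge_zero order_trans by blast
  have contG: "continuous_on A G" for A
    using lipschitz_on_continuous_on[OF lip] continuous_on_subset by blast
  define h where "h = (\<lambda>(z :: real \<Rightarrow>\<^sub>C 'a) s. G (x0 + exp (K * \<bar>s\<bar>) *\<^sub>R z s))"
  have cont_h: "continuous_on UNIV (h z)" for z
    unfolding h_def by (intro continuous_on_compose2[OF contG[of UNIV]] continuous_intros) auto
  have "\<exists>P. P 0 = 0 \<and> (\<forall>s. (P has_vector_derivative h z s) (at s))" for z
  proof -
    have "\<exists>Q. \<forall>s::real. - \<infinity> < ereal s \<longrightarrow> ereal s < \<infinity> \<longrightarrow> (Q has_vector_derivative h z s) (at s)"
      by (rule einterval_antiderivative) (use cont_h[of z] in \<open>auto simp: continuous_on_eq_continuous_at\<close>)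
    then obtain Q where Q: "\<And>s. (Q has_vector_derivative h z s) (at s)"
      by auto
    have "((\<lambda>s. Q s - Q 0) has_vector_derivative h z s) (at s)" for s
      using has_vector_derivative_diff[OF Q has_vector_derivative_const] by simp
    then show ?thesis
      by (intro exI[of _ "\<lambda>s. Q s - Q 0"]) auto
  qed
  then obtain P where P0: "\<And>z. P z 0 = 0" and P: "\<And>z s. (P z has_vector_derivative h z s) (at s)"
    by metis
  have norm_P: "norm (P z t) \<le> M / K * exp (K * \<bar>t\<bar>)" for z t
  proof (rule primitive_exp_bound[OF P P0])
    fix s
    have "M * 1 \<le> M * exp (K * \<bar>s\<bar>)"
      using M K by (intro mult_left_mono) auto
    then show "norm (h z s) \<le> M * exp (K * \<bar>s\<bar>)"
      using order_trans[OF bnd] unfolding h_def by simp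
  qed (use K in auto)
  have dist_P: "norm (P z t - P w t) \<le> L * dist z w / K * exp (K * \<bar>t\<bar>)" for z w t
  proof (rule primitive_exp_bound)
    show "((\<lambda>t. P z t - P w t) has_vector_derivative h z s - h w s) (at s)" for s
      by (intro has_vector_derivative_diff P)
    fix s
    have "norm (h z s - h w s) \<le> L * norm ((x0 + exp (K * \<bar>s\<bar>) *\<^sub>R z s) - (x0 + exp (K * \<bar>s\<bar>) *\<^sub>R w s))"
      unfolding h_def by (rule lipschitz_onD[OF lip UNIV_I UNIV_I, unfolded dist_norm])
    also have "\<dots> = L * (exp (K * \<bar>s\<bar>) * dist (z s) (w s))"
      by (simp add: dist_norm scaleR_diff_right[symmetric])
    also have "\<dots> \<le> L * (exp (K * \<bar>s\<bar>) * dist z w)"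
      using L by (intro mult_left_mono dist_bounded) auto
    finally show "norm (h z s - h w s) \<le> L * dist z w * exp (K * \<bar>s\<bar>)"
      by (simp add: mult_ac)
  qed (use K P0 in auto)
  define \<Phi> where "\<Phi> = (\<lambda>z. Bcontfun (\<lambda>t. exp (- (K * \<bar>t\<bar>)) *\<^sub>R P z t))"
  have apply_\<Phi>: "\<Phi> z t = exp (- (K * \<bar>t\<bar>)) *\<^sub>R P z t" for z t
  proof -
    have "continuous_on UNIV (P z)"
      using P by (intro continuous_at_imp_continuous_on) (blast intro: has_vector_derivative_continuous)
    then have "continuous_on UNIV (\<lambda>t. exp (- (K * \<bar>t\<bar>)) *\<^sub>R P z t)"
      by (intro continuous_intros)
    moreover have "norm (exp (- (K * \<bar>t\<bar>)) *\<^sub>R P z t) \<le> M / K" for t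
      using norm_P[of z t] by (simp add: exp_minus field_simps)
    then have "bounded (range (\<lambda>t. exp (- (K * \<bar>t\<bar>)) *\<^sub>R P z t))"
      unfolding bounded_iff by blast
    ultimately have "(\<lambda>t. exp (- (K * \<bar>t\<bar>)) *\<^sub>R P z t) \<in> bcontfun"
      by (simp add: bcontfun_def)
    then show ?thesis
      by (simp add: \<Phi>_def Bcontfun_inverse)
  qed
  have "dist (\<Phi> z) (\<Phi> w) \<le> 1 / 2 * dist z w" for z w
  proof (rule dist_bound)
    fix t
    have "dist (\<Phi> z t) (\<Phi> w t) = exp (- (K * \<bar>t\<bar>)) * norm (P z t - P w t)"
      by (simp add: apply_\<Phi> dist_norm scaleR_diff_right[symmetric])
    also have "\<dots> \<le> exp (- (K * \<bar>t\<bar>)) * (L * dist z w / K * exp (K * \<bar>t\<bar>))"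
      by (intro mult_left_mono dist_P) auto
    also have "\<dots> = L / K * dist z w"
      by (simp add: exp_minus)
    also have "\<dots> \<le> 1 / 2 * dist z w"
      by (intro mult_right_mono K) auto
    finally show "dist (\<Phi> z t) (\<Phi> w t) \<le> 1 / 2 * dist z w" .
  qed
  then obtain z where z: "\<Phi> z = z"
    using banach_fix_type[of "1/2" \<Phi>] by auto
  have y: "P z t = exp (K * \<bar>t\<bar>) *\<^sub>R z t" for t
  proof -
    have "z t = exp (- (K * \<bar>t\<bar>)) *\<^sub>R P z t"
      using apply_\<Phi>[of z t] z by simp
    then show ?thesis
      by (simp add: exp_minus)
  qed
  show ?thesis
  proof (rule that[of "\<lambda>t. x0 + P z t"])
    show "((\<lambda>t. x0 + P z t) has_vector_derivative G (x0 + P z t)) (at t)" for t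
      using has_vector_derivative_add[OF has_vector_derivative_const P, of x0 z t]
      by (simp add: h_def y[symmetric])
  qed (simp add: P0)
qed

text \<open>Lipschitz continuity on bounded sets: every bounded set lies in such a ball.\<close>
definition lipschitz_on_balls :: "('a::real_normed_vector \<Rightarrow> 'b::real_normed_vector) \<Rightarrow> bool" where
  "lipschitz_on_balls F \<longleftrightarrow> (\<forall>R. \<exists>L. L-lipschitz_on (cball 0 R) F)"

lemma lipschitz_on_balls_uminus:
  "lipschitz_on_balls F \<Longrightarrow> lipschitz_on_balls (\<lambda>u. - F u)"
  by (simp add: lipschitz_on_balls_def)

text \<open>Gronwall's argument: \<open>exp (-2Ls) \<parallel>x s - y s\<parallel>\<^sup>2\<close> does not increase.\<close>
lemma solution_unique_forward:
  fixes x y :: "real \<Rightarrow> 'a::euclidean_space"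
  assumes lip: "lipschitz_on_balls F" and b: "0 \<le> b"
    and x: "\<And>t. 0 \<le> t \<Longrightarrow> t \<le> b \<Longrightarrow> (x has_vector_derivative F (x t)) (at t)"
    and y: "\<And>t. 0 \<le> t \<Longrightarrow> t \<le> b \<Longrightarrow> (y has_vector_derivative F (y t)) (at t)"
    and init: "x 0 = y 0"
  shows "x b = y b"
proof -
  have "continuous_on {0..b} x" "continuous_on {0..b} y"
    using x y by (auto intro!: continuous_at_imp_continuous_on has_vector_derivative_continuous)
  then have "bounded (x ` {0..b} \<union> y ` {0..b})"
    by (auto intro!: compact_imp_bounded compact_continuous_image)
  then obtain R where R: "x ` {0..b} \<union> y ` {0..b} \<subseteq> cball 0 R"
    unfolding bounded_iff by (metis mem_cball_0 subsetI)
  obtain L where L: "L-lipschitz_on (cball 0 R) F"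
    using lip unfolding lipschitz_on_balls_def by blast
  define \<phi> where "\<phi> = (\<lambda>s. exp (- 2 * L * s) * ((x s - y s) \<bullet> (x s - y s)))"
  have "\<phi> b \<le> \<phi> 0"
  proof (rule DERIV_nonpos_imp_nonincreasing[OF b])
    fix s assume s: "0 \<le> s" "s \<le> b"
    have d: "((\<lambda>s. x s - y s) has_vector_derivative F (x s) - F (y s)) (at s)"
      by (intro has_vector_derivative_diff x y s)
    have deriv_\<phi>: "(\<phi> has_real_derivative
        exp (- 2 * L * s) * (2 * ((x s - y s) \<bullet> (F (x s) - F (y s))) - 2 * L * ((x s - y s) \<bullet> (x s - y s)))) (at s)"
    proof -
      have "((\<lambda>s. (x s - y s) \<bullet> (x s - y s)) has_derivative
          (\<lambda>h. (x s - y s) \<bullet> (h *\<^sub>R (F (x s) - F (y s))) + (h *\<^sub>R (F (x s) - F (y s))) \<bullet> (x s - y s))) (at s)"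
        using d unfolding has_vector_derivative_def by (intro has_derivative_inner)
      then have deriv: "((\<lambda>s. (x s - y s) \<bullet> (x s - y s)) has_real_derivative
          2 * ((x s - y s) \<bullet> (F (x s) - F (y s)))) (at s)"
        unfolding has_field_derivative_def
        by (rule has_derivative_eq_rhs) (auto simp: inner_commute)
      have "((\<lambda>s. exp (- 2 * L * s)) has_real_derivative - 2 * L * exp (- 2 * L * s)) (at s)"
        by (auto intro!: derivative_eq_intros)
      from DERIV_mult[OF this deriv] show ?thesis
        unfolding \<phi>_def by (rule DERIV_cong) (simp add: field_simps)
    qed
    have "(x s - y s) \<bullet> (F (x s) - F (y s)) \<le> L * ((x s - y s) \<bullet> (x s - y s))"
    proof -
      have "(x s - y s) \<bullet> (F (x s) - F (y s)) \<le> norm (x s - y s) * norm (F (x s) - F (y s))"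
        by (rule norm_cauchy_schwarz)
      also have "\<dots> \<le> norm (x s - y s) * (L * norm (x s - y s))"
        using lipschitz_onD[OF L, of "x s" "y s"] R s
        by (intro mult_left_mono) (auto simp: dist_norm image_subset_iff)
      finally show ?thesis
        by (simp add: dot_square_norm power2_eq_square mult_ac)
    qed
    then have "exp (- 2 * L * s) *
        (2 * ((x s - y s) \<bullet> (F (x s) - F (y s))) - 2 * L * ((x s - y s) \<bullet> (x s - y s))) \<le> 0"
      by (intro mult_nonneg_nonpos) auto
    with deriv_\<phi> show "\<exists>D. (\<phi> has_real_derivative D) (at s) \<and> D \<le> 0"
      by blast
  qed
  then have "(x b - y b) \<bullet> (x b - y b) \<le> 0"
    using init by (simp add: \<phi>_def mult_le_0_iff)
  then have "(x b - y b) \<bullet> (x b - y b) = 0"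
    using inner_ge_zero by (intro antisym)
  then show ?thesis
    by simp
qed

lemma ode_solution_unique:
  fixes F :: "real ^ 'n::finite \<Rightarrow> real ^ 'n"
  assumes lip: "lipschitz_on_balls F"
    and x: "ode_solution F x0 I x" and y: "ode_solution F x0 J y" and t: "t \<in> I" "t \<in> J"
  shows "x t = y t"
proof -
  have between: "s \<in> I \<and> s \<in> J" if "0 \<le> s \<and> s \<le> t \<or> t \<le> s \<and> s \<le> 0" for s
  proof -
    have iv: "is_interval I" "is_interval J" "0 \<in> I" "0 \<in> J"
      using x y by (auto simp: ode_solution_def)
    show ?thesis
      using that mem_is_interval_1_I[OF iv(1), of 0 t s] mem_is_interval_1_I[OF iv(1), of t 0 s]
        mem_is_interval_1_I[OF iv(2), of 0 t s] mem_is_interval_1_I[OF iv(2), of t 0 s] iv t by blast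
  qed
  have init: "x 0 = y 0"
    using x y by (simp add: ode_solution_def)
  show ?thesis
  proof (cases "t \<ge> 0")
    case True
    show ?thesis
      by (rule solution_unique_forward[where F = F and x = x and y = y])
        (use lip True init between x y in \<open>auto simp: ode_solution_def\<close>)
  next
    case False
    have "x (- (- t)) = y (- (- t))"
      by (rule solution_unique_forward[OF lipschitz_on_balls_uminus[OF lip],
            of "- t" "\<lambda>s. x (- s)" "\<lambda>s. y (- s)"])
        (use between x y init False in \<open>auto simp: ode_solution_def intro!: has_vector_derivative_reflect\<close>)
    then show ?thesis
      by simp
  qed
qed

text \<open>The maximal solution is the union of all solutions.\<close>
lemma traj_eq_solution:
  fixes F :: "real ^ 'n::finite \<Rightarrow> real ^ 'n"
  assumes lip: "lipschitz_on_balls F" and sol: "ode_solution F x0 J y" and t: "t \<in> J"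
  shows "t \<in> traj_dom F x0 \<and> traj F x0 t = y t"
proof -
  define I where "I = \<Union>{J. \<exists>y. ode_solution F x0 J y}"
  define x where "x = (\<lambda>t. SOME v. \<exists>J y. ode_solution F x0 J y \<and> t \<in> J \<and> y t = v)"
  have x_eq: "x t = y t" if "ode_solution F x0 J y" "t \<in> J" for J y t
  proof -
    have "\<exists>J y. ode_solution F x0 J y \<and> t \<in> J \<and> y t = x t"
      unfolding x_def by (rule someI_ex) (use that in blast)
    then show ?thesis
      using ode_solution_unique[OF lip] that by metis
  qed
  have sol_I: "ode_solution F x0 I x"
    unfolding ode_solution_def
  proof (intro conjI ballI)
    show "open I"
      unfolding I_def by (auto simp: ode_solution_def)
    have "connected I"
      unfolding I_def
      by (rule connected_Union) (auto simp: ode_solution_def is_interval_connected_1)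
    then show "is_interval I"
      by (simp add: is_interval_connected_1)
    have "0 \<in> J"
      using sol by (auto simp: ode_solution_def)
    then show "0 \<in> I"
      using sol unfolding I_def by blast
    show "x 0 = x0"
      using x_eq[OF sol, of 0] sol by (auto simp: ode_solution_def)
    fix s assume "s \<in> I"
    then obtain J y where J: "ode_solution F x0 J y" "s \<in> J"
      unfolding I_def by blast
    have "(y has_vector_derivative F (x s)) (at s)"
      using J x_eq[OF J] by (auto simp: ode_solution_def)
    then show "(x has_vector_derivative F (x s)) (at s)"
      by (rule has_vector_derivative_transform_within_open[of _ _ _ J])
        (use J x_eq in \<open>auto simp: ode_solution_def\<close>)
  qed
  have max_I: "maximal_solution F x0 I x"
    unfolding maximal_solution_def using sol_I by (auto simp: I_def)
  have unique: "I' = I" if "maximal_solution F x0 I' x'" for I' x'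
  proof -
    have sol': "ode_solution F x0 I' x'"
      using that by (simp add: maximal_solution_def)
    then have "I' \<subseteq> I" "\<forall>t\<in>I'. x t = x' t"
      using x_eq by (auto simp: I_def)
    then show ?thesis
      using that sol_I unfolding maximal_solution_def by blast
  qed
  have dom: "traj_dom F x0 = I"
    unfolding traj_dom_def using max_I unique by (intro the_equality) blast+
  have "t \<in> I"
    using sol t by (auto simp: I_def)
  moreover have "traj F x0 t = x t"
    unfolding traj_def
  proof (rule the_equality)
    show "\<exists>I x'. maximal_solution F x0 I x' \<and> t \<in> I \<and> x' t = x t"
      using max_I \<open>t \<in> I\<close> by blast
    show "v = x t" if "\<exists>I x'. maximal_solution F x0 I x' \<and> t \<in> I \<and> x' t = v" for v
    proof -
      from that obtain I' x' where "maximal_solution F x0 I' x'" "t \<in> I'" "x' t = v"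
        by blast
      then show "v = x t"
        using x_eq[of I' x' t] by (simp add: maximal_solution_def)
    qed
  qed
  ultimately show ?thesis
    using dom x_eq[OF sol t] by simp
qed

text \<open>A trajectory stays in the interior of a compact set \<open>X\<close> during \<open>{0..t}\<close> if it is never on the
  boundary of \<open>X\<close> at a time up to which it has stayed in \<open>X\<close>. To know that the trajectory exists
  until then, \<open>F\<close> is replaced outside a large ball by its value at the nearest point of the ball; the
  solution of the modified equation is global, and solves the original one as long as it is in \<open>X\<close>.\<close>
lemma stays_in_interior:
  fixes F :: "real ^ 'n::finite \<Rightarrow> real ^ 'n"
  assumes lip: "lipschitz_on_balls F" and X: "compact X" and x0: "x0 \<in> interior X"
    and no_exit: "\<And>y s. 0 \<le> s \<Longrightarrow> s \<le> t \<Longrightarrow> y 0 = x0 \<Longrightarrow>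
      (\<And>r. 0 \<le> r \<Longrightarrow> r \<le> s \<Longrightarrow> y r \<in> X \<and> (y has_vector_derivative F (y r)) (at r)) \<Longrightarrow> y s \<in> interior X"
    and s: "0 \<le> s" "s \<le> t"
  shows "s \<in> traj_dom F x0 \<and> traj F x0 s \<in> interior X"
proof -
  have "bounded X"
    using X by (rule compact_imp_bounded)
  then obtain R where R: "X \<subseteq> ball 0 R" "R > 0"
    using bounded_subset_ballD by blast
  have XR: "u \<in> cball 0 R" if "u \<in> X" for u
    using that R by auto
  let ?B = "cball (0 :: real ^ 'n) R"
  let ?c = "closest_point ?B"
  have c_in: "?c u \<in> ?B" for u
    using R by (intro closest_point_in_set) auto
  obtain L where L: "L-lipschitz_on ?B F"
    using lip unfolding lipschitz_on_balls_def by blast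
  define G where "G = (\<lambda>u. F (?c u))"
  have "L-lipschitz_on UNIV G"
  proof (rule lipschitz_onI)
    show "0 \<le> L"
      using L by (rule lipschitz_on_nonneg)
    fix u v :: "real ^ 'n"
    have "dist (G u) (G v) \<le> L * dist (?c u) (?c v)"
      unfolding G_def by (intro lipschitz_onD[OF L] c_in)
    also have "\<dots> \<le> L * dist u v"
      using R \<open>0 \<le> L\<close> by (intro mult_left_mono closest_point_lipschitz) auto
    finally show "dist (G u) (G v) \<le> L * dist u v" .
  qed
  moreover have "bounded (F ` ?B)"
    using L by (intro compact_imp_bounded compact_continuous_image lipschitz_on_continuous_on) auto
  then obtain M where "\<And>u. u \<in> ?B \<Longrightarrow> norm (F u) \<le> M"
    unfolding bounded_iff by blast
  then have "norm (G u) \<le> M" for u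
    using c_in by (simp add: G_def)
  ultimately obtain y where y0: "y 0 = x0" and yG: "\<And>t. (y has_vector_derivative G (y t)) (at t)"
    using global_solution by blast
  have yF: "(y has_vector_derivative F (y r)) (at r)" if "y r \<in> ?B" for r
    using yG[of r] closest_point_self[OF that] by (simp add: G_def)
  have cont: "continuous_on A y" for A
    using yG by (intro continuous_at_imp_continuous_on) (blast intro: has_vector_derivative_continuous)
  have stay: "y r \<in> interior X" if "0 \<le> r" "r \<le> t" for r
  proof (rule ccontr)
    assume "y r \<notin> interior X"
    define E where "E = {0..t} \<inter> y -` (- interior X)"
    have "closed E"
      unfolding E_def by (intro continuous_closed_preimage cont) auto
    moreover have "E \<noteq> {}" "bdd_below E"
      using that \<open>y r \<notin> interior X\<close> by (auto simp: E_def)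
    ultimately have "Inf E \<in> E"
      by (intro closed_contains_Inf)
    define \<sigma> where "\<sigma> = Inf E"
    have \<sigma>: "0 \<le> \<sigma>" "\<sigma> \<le> t" "y \<sigma> \<notin> interior X"
      using \<open>Inf E \<in> E\<close> by (auto simp: E_def \<sigma>_def)
    have before: "y q \<in> interior X" if "0 \<le> q" "q < \<sigma>" for q
      using cInf_lower[OF _ \<open>bdd_below E\<close>, of q] that \<sigma> by (auto simp: E_def \<sigma>_def)
    have "\<sigma> \<noteq> 0"
      using \<sigma> x0 y0 by auto
    then have "\<sigma> > 0"
      using \<sigma> by simp
    have "y ` closure {0..<\<sigma>} \<subseteq> X"
      by (rule image_closure_subset[OF cont])
        (use before interior_subset[of X] X in \<open>auto intro: compact_imp_closed\<close>)
    then have "y q \<in> X" if "0 \<le> q" "q \<le> \<sigma>" for q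
      using that \<open>\<sigma> > 0\<close> by auto
    then have "y \<sigma> \<in> interior X"
      using \<sigma> by (intro no_exit y0 conjI yF XR) auto
    with \<sigma> show False
      by simp
  qed
  define W where "W = y -` ball 0 R"
  have "open W"
    unfolding W_def by (rule open_vimage[OF open_ball cont])
  have W: "{0..t} \<subseteq> W"
    using stay interior_subset R by (fastforce simp: W_def)
  define J where "J = connected_component_set W 0"
  have J: "{0..t} \<subseteq> J"
    unfolding J_def using s W by (intro connected_component_maximal) auto
  have "ode_solution F x0 J y"
    unfolding ode_solution_def
  proof (intro conjI ballI)
    show "open J"
      unfolding J_def by (rule open_connected_component[OF \<open>open W\<close>])
    show "is_interval J"
      unfolding J_def is_interval_connected_1 by (rule connected_connected_component)
    show "0 \<in> J"
      using J s by auto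
    fix r assume "r \<in> J"
    then have "r \<in> W"
      unfolding J_def using connected_component_subset by blast
    then show "(y has_vector_derivative F (y r)) (at r)"
      by (intro yF) (auto simp: W_def)
  qed (rule y0)
  then have "s \<in> traj_dom F x0 \<and> traj F x0 s = y s"
    using J s by (intro traj_eq_solution[OF lip]) auto
  then show ?thesis
    using stay[OF s] by simp
qed

section \<open>Barrier certificates\<close>

lemma lipschitz_on_balls_vector_field:
  fixes f :: "'n::finite \<Rightarrow> 'n rpoly"
  shows "lipschitz_on_balls (vector_field f)"
  unfolding lipschitz_on_balls_def
proof
  fix R :: real
  let ?B = "cball (0 :: real ^ 'n) R"
  have "\<exists>C. \<forall>u\<in>?B. \<forall>v\<in>?B. norm (peval p u - peval p v) \<le> C * norm (u - v)" for p :: "'n rpoly"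
  proof -
    have "bounded ((\<lambda>u. \<Sum>i\<in>UNIV. \<bar>peval (partial_deriv i p) u\<bar>) ` ?B)"
      by (intro compact_imp_bounded compact_continuous_image continuous_intros compact_cball)
    then obtain C where C: "\<And>u. u \<in> ?B \<Longrightarrow> norm (\<Sum>i\<in>UNIV. \<bar>peval (partial_deriv i p) u\<bar>) \<le> C"
      unfolding bounded_iff by blast
    have "norm (peval p u - peval p v) \<le> C * norm (u - v)" if "u \<in> ?B" "v \<in> ?B" for u v
    proof (rule differentiable_bound[OF convex_cball _ _ that])
      fix w assume w: "w \<in> ?B"
      show "(peval p has_derivative (\<lambda>h. \<Sum>i\<in>UNIV. peval (partial_deriv i p) w * h $ i)) (at w within ?B)"
        by (rule has_derivative_at_withinI[OF has_derivative_peval])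
      show "onorm (\<lambda>h. \<Sum>i\<in>UNIV. peval (partial_deriv i p) w * h $ i) \<le> C"
      proof (rule onorm_le)
        fix h :: "real ^ 'n"
        have "norm (\<Sum>i\<in>UNIV. peval (partial_deriv i p) w * h $ i) \<le>
            (\<Sum>i\<in>UNIV. \<bar>peval (partial_deriv i p) w\<bar> * norm h)"
          by (intro sum_norm_le) (simp add: abs_mult mult_left_mono component_le_norm_cart)
        also have "\<dots> \<le> C * norm h"
          unfolding sum_distrib_right[symmetric] using C[OF w] by (intro mult_right_mono) auto
        finally show "norm (\<Sum>i\<in>UNIV. peval (partial_deriv i p) w * h $ i) \<le> C * norm h" .
      qed
    qed
    then show ?thesis
      by blast
  qed
  then obtain C where C: "\<And>p u v. u \<in> ?B \<Longrightarrow> v \<in> ?B \<Longrightarrow> norm (peval p u - peval p v) \<le> C p * norm (u - v)"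
    by metis
  have "(\<Sum>i\<in>UNIV. \<bar>C (f i)\<bar>)-lipschitz_on ?B (vector_field f)"
  proof (rule lipschitz_onI)
    fix u v assume uv: "u \<in> ?B" "v \<in> ?B"
    have "dist (vector_field f u) (vector_field f v) \<le> (\<Sum>i\<in>UNIV. \<bar>(vector_field f u - vector_field f v) $ i\<bar>)"
      unfolding dist_norm by (rule norm_le_l1_cart)
    also have "\<dots> \<le> (\<Sum>i\<in>UNIV. \<bar>C (f i)\<bar> * dist u v)"
    proof (rule sum_mono)
      fix i
      have "\<bar>(vector_field f u - vector_field f v) $ i\<bar> \<le> C (f i) * dist u v"
        using C[OF uv, of "f i"] by (simp add: vector_field_def dist_norm)
      also have "\<dots> \<le> \<bar>C (f i)\<bar> * dist u v"
        by (intro mult_right_mono) auto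
      finally show "\<bar>(vector_field f u - vector_field f v) $ i\<bar> \<le> \<bar>C (f i)\<bar> * dist u v" .
    qed
    finally show "dist (vector_field f u) (vector_field f v) \<le> (\<Sum>i\<in>UNIV. \<bar>C (f i)\<bar>) * dist u v"
      by (simp add: sum_distrib_right)
  qed (simp add: sum_nonneg)
  then show "\<exists>L. L-lipschitz_on ?B (vector_field f)"
    by blast
qed

text \<open>A point where all \<open>g i\<close> are positive is interior, so at every other point of the set some
  \<open>g i\<close> vanishes.\<close>
lemma prod_eq_0_on_boundary:
  fixes g :: "'m::finite \<Rightarrow> 'n::finite rpoly"
  assumes "x \<in> semialg g" "x \<notin> interior (semialg g)"
  shows "(\<Prod>i\<in>UNIV. peval (g i) x) = 0"
proof (rule ccontr)
  assume "(\<Prod>i\<in>UNIV. peval (g i) x) \<noteq> 0"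
  then have nz: "peval (g i) x \<noteq> 0" for i
    by (simp add: prod_zero_iff)
  have "0 < peval (g i) x" for i
    using assms(1) nz[of i] by (auto simp: semialg_def less_le)
  moreover have "open (\<Inter>i\<in>UNIV. peval (g i) -` {0<..})"
    by (intro open_INT finite ballI open_vimage continuous_on_peval open_greaterThan)
  moreover have "(\<Inter>i\<in>UNIV. peval (g i) -` {0<..}) \<subseteq> semialg g"
    by (auto simp: semialg_def intro: less_imp_le)
  ultimately have "x \<in> interior (semialg g)"
    by (intro interiorI) auto
  with assms(2) show False
    by simp
qed

lemma sos_certificate_nonneg:
  assumes "q0 \<in> sos_upto a" "\<And>i. q i \<in> sos_upto (b i)" "x \<in> semialg g"
  shows "0 \<le> peval (q0 + (\<Sum>i\<in>UNIV. q i * g i)) x"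
proof -
  have "0 \<le> peval q0 x" "\<And>i. 0 \<le> peval (q i) x" "\<And>i. 0 \<le> peval (g i) x"
    using sos_upto_nonneg[OF assms(1)] sos_upto_nonneg[OF assms(2)] assms(3) by (auto simp: semialg_def)
  then show ?thesis
    by (simp add: sum_nonneg)
qed

text \<open>Along a trajectory in \<open>X\<close>, \<open>v\<close> grows at most at the rate \<open>u\<close>, so it remains negative up to time \<open>t\<close>
  if \<open>v x0 + u * t < 0\<close>, whereas it is nonnegative on the boundary of \<open>X\<close>.\<close>
lemma inner_approximation:
  assumes z: "z \<in> sos_feasible f g k" and X: "compact (semialg g)"
    and x0: "x0 \<in> interior (semialg g)" and neg: "peval (sol_v z) x0 + sol_u z * t < 0"
    and s: "0 \<le> s" "s \<le> t"
  shows "s \<in> traj_dom (vector_field f) x0 \<and> traj (vector_field f) x0 s \<in> interior (semialg g)"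
proof (rule stays_in_interior[OF lipschitz_on_balls_vector_field X x0 _ s])
  fix y s
  assume s: "0 \<le> s" "s \<le> t" and y0: "y 0 = x0"
    and y: "\<And>r. 0 \<le> r \<Longrightarrow> r \<le> s \<Longrightarrow>
      y r \<in> semialg g \<and> (y has_vector_derivative vector_field f (y r)) (at r)"
  let ?u = "sol_u z" and ?v = "sol_v z"
  have u: "0 \<le> ?u"
    using z by (simp add: sos_feasible_def)
  have growth: "peval (grad_dot ?v f) x \<le> ?u" if "x \<in> semialg g" for x
  proof -
    have "0 \<le> peval (sol_p0 z + (\<Sum>i\<in>UNIV. sol_p z i * g i)) x"
      using z that by (intro sos_certificate_nonneg) (auto simp: sos_feasible_def)
    also have "sol_p0 z + (\<Sum>i\<in>UNIV. sol_p z i * g i) = Const ?u - grad_dot ?v f"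
      using z unfolding sos_feasible_def by (elim CollectE conjE) (rule sym)
    finally show ?thesis
      by simp
  qed
  have "peval ?v (y s) - ?u * s \<le> peval ?v (y 0) - ?u * 0"
  proof (rule DERIV_nonpos_imp_nonincreasing[OF s(1)])
    fix r assume r: "0 \<le> r" "r \<le> s"
    have "((\<lambda>r. peval ?v (y r) - ?u * r) has_real_derivative peval (grad_dot ?v f) (y r) - ?u) (at r)"
      using y[OF r] by (auto intro!: derivative_eq_intros peval_deriv_along_solution)
    then show "\<exists>D. ((\<lambda>r. peval ?v (y r) - ?u * r) has_real_derivative D) (at r) \<and> D \<le> 0"
      using growth[of "y r"] y[OF r] by auto
  qed
  moreover have "?u * s \<le> ?u * t"
    using u s by (intro mult_left_mono)
  ultimately have v_neg: "peval ?v (y s) < 0"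
    using neg y0 by simp
  show "y s \<in> interior (semialg g)"
  proof (rule ccontr)
    assume *: "y s \<notin> interior (semialg g)"
    have X_s: "y s \<in> semialg g"
      using y s by simp
    have "?v = sol_t0 z + (\<Sum>i\<in>UNIV. sol_t z i * g i) + sol_r z * (\<Prod>i\<in>UNIV. g i)"
      using z by (simp add: sos_feasible_def)
    then have "peval ?v (y s) = peval (sol_t0 z + (\<Sum>i\<in>UNIV. sol_t z i * g i)) (y s)"
      using prod_eq_0_on_boundary[OF X_s *] by simp
    also have "\<dots> \<ge> 0"
      using z X_s by (intro sos_certificate_nonneg) (auto simp: sos_feasible_def)
    finally show False
      using v_neg by simp
  qed
qed

section \<open>Gram matrices\<close>

lemma psd_matrix_cong:
  assumes "\<And>a b. a < m \<Longrightarrow> b < m \<Longrightarrow> A a b = A' a b"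
  shows "psd_matrix m A \<longleftrightarrow> psd_matrix m A'"
proof -
  have "(\<Sum>a<m. \<Sum>b<m. A a b * x a * x b) = (\<Sum>a<m. \<Sum>b<m. A' a b * x a * x b)" for x :: "nat \<Rightarrow> real"
    using assms by (intro sum.cong) auto
  then show ?thesis
    using assms by (auto simp: psd_matrix_def sym_matrix_def)
qed

lemma quadratic_form_Suc:
  fixes A :: "nat \<Rightarrow> nat \<Rightarrow> real"
  assumes "sym_matrix (Suc m) A"
  shows "(\<Sum>a<Suc m. \<Sum>b<Suc m. A a b * (x(m := t)) a * (x(m := t)) b) =
    (\<Sum>a<m. \<Sum>b<m. A a b * x a * x b) + 2 * t * (\<Sum>a<m. A a m * x a) + A m m * t\<^sup>2"
proof -
  have "A m a = A a m" if "a < m" for a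
    using assms that by (simp add: sym_matrix_def)
  then have "(\<Sum>b<m. A m b * t * x b) = t * (\<Sum>a<m. A a m * x a)"
    by (simp add: sum_distrib_left mult_ac)
  moreover have "(\<Sum>a<m. A a m * x a * t) = t * (\<Sum>a<m. A a m * x a)"
    by (simp add: sum_distrib_left mult_ac)
  ultimately show ?thesis
    by (simp add: sum.distrib power2_eq_square algebra_simps)
qed

text \<open>Cholesky factorization: the last row of \<open>A\<close>, divided by the square root of the last diagonal
  entry, is split off, and the Schur complement is again positive semidefinite.\<close>
lemma psd_matrix_factorization:
  assumes "psd_matrix m A"
  shows "\<exists>(l::nat) h. \<forall>a<m. \<forall>b<m. A a b = (\<Sum>j<l. h j a * h j b)"
  using assms
proof (induction m arbitrary: A)
  case 0
  then show ?case
    by simp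
next
  case (Suc m)
  define c where "c = A m m"
  define lin where "lin = (\<lambda>x. \<Sum>a<m. A a m * x a)"
  define q where "q = (\<lambda>x :: nat \<Rightarrow> real. \<Sum>a<m. \<Sum>b<m. A a b * x a * x b)"
  have sym: "sym_matrix (Suc m) A"
    using Suc.prems by (simp add: psd_matrix_def)
  have quad: "0 \<le> q x + 2 * t * lin x + c * t\<^sup>2" for x t
  proof -
    have "0 \<le> (\<Sum>a<Suc m. \<Sum>b<Suc m. A a b * (x(m := t)) a * (x(m := t)) b)"
      using Suc.prems unfolding psd_matrix_def by blast
    then show ?thesis
      unfolding quadratic_form_Suc[OF sym] q_def lin_def c_def .
  qed
  have c_nonneg: "0 \<le> c"
    using quad[of "\<lambda>_. 0" 1] by (simp add: q_def lin_def)
  have lin_0: "lin x = 0" if "c = 0" for x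
  proof (rule ccontr)
    assume "lin x \<noteq> 0"
    then show False
      using quad[of x "- (q x + 1) / (2 * lin x)"] that by (simp add: field_simps)
  qed
  have last_0: "A a m = 0" if "c = 0" "a < m" for a
  proof -
    have "lin (\<lambda>i. if i = a then 1 else 0) = A a m"
      using that by (simp add: lin_def if_distrib cong: if_cong)
    then show ?thesis
      using lin_0 that by simp
  qed
  \<comment> \<open>If \<open>c = 0\<close>, division by zero makes \<open>r\<close> vanish, in accordance with \<open>last_0\<close>.\<close>
  define r where "r = (\<lambda>a. A a m / sqrt c)"
  have r: "r a * r m = A a m" if "a < Suc m" for a
    using c_nonneg last_0[of a] that by (cases "c = 0"; cases "a = m") (auto simp: r_def c_def[symmetric])
  have "psd_matrix m (\<lambda>a b. A a b - r a * r b)"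
    unfolding psd_matrix_def
  proof (intro conjI allI)
    show "sym_matrix m (\<lambda>a b. A a b - r a * r b)"
      using sym by (auto simp: sym_matrix_def mult.commute)
    fix x :: "nat \<Rightarrow> real"
    have "(\<Sum>a<m. \<Sum>b<m. (A a b - r a * r b) * x a * x b) = q x - (\<Sum>a<m. r a * x a) * (\<Sum>b<m. r b * x b)"
      unfolding q_def sum_product by (simp add: sum_subtractf algebra_simps)
    also have "(\<Sum>a<m. r a * x a) = lin x / sqrt c"
      by (simp add: lin_def r_def sum_divide_distrib)
    also have "q x - lin x / sqrt c * (lin x / sqrt c) = q x - (lin x)\<^sup>2 / c"
      using c_nonneg by (simp add: power2_eq_square)
    also have "\<dots> = q x + 2 * (- lin x / c) * lin x + c * (- lin x / c)\<^sup>2"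
      by (cases "c = 0") (auto simp: power2_eq_square field_simps)
    also have "\<dots> \<ge> 0"
      by (rule quad)
    finally show "0 \<le> (\<Sum>a<m. \<Sum>b<m. (A a b - r a * r b) * x a * x b)" .
  qed
  then obtain l :: nat and h where h: "\<And>a b. a < m \<Longrightarrow> b < m \<Longrightarrow> A a b - r a * r b = (\<Sum>j<l. h j a * h j b)"
    using Suc.IH by blast
  define h' where "h' = (\<lambda>j a. if j < l then (if a < m then h j a else 0) else r a)"
  have "A a b = (\<Sum>j<Suc l. h' j a * h' j b)" if "a < Suc m" "b < Suc m" for a b
  proof -
    have "(\<Sum>j<Suc l. h' j a * h' j b) = (\<Sum>j<l. (if a < m then h j a else 0) * (if b < m then h j b else 0)) + r a * r b"
      by (simp add: h'_def)
    also have "\<dots> = A a b"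
    proof (cases "a < m \<and> b < m")
      case True
      then show ?thesis
        using h[of a b] by simp
    next
      case False
      then have "(\<Sum>j<l. (if a < m then h j a else 0) * (if b < m then h j b else 0)) = 0"
        by (intro sum.neutral) auto
      moreover have "a = m \<or> b = m"
        using False that by auto
      then have "r a * r b = A a b"
        using r[of a] r[of b] that sym by (auto simp: sym_matrix_def mult.commute)
      ultimately show ?thesis
        by simp
    qed
    finally show ?thesis
      by simp
  qed
  then show ?case
    by blast
qed

lemma tdegree_sum_le: "(\<And>i. i \<in> A \<Longrightarrow> tdegree (p i) \<le> d) \<Longrightarrow> tdegree (\<Sum>i\<in>A. p i) \<le> d"
proof (induction A rule: infinite_finite_induct)
  case (insert i A)
  then show ?case
    using keys_add[of "p i" "\<Sum>i\<in>A. p i"] by (auto simp: tdegree_le_iff)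
qed (auto simp: tdegree_le_iff)

lemma tdegree_single_le: "mdeg m \<le> d \<Longrightarrow> tdegree (Poly_Mapping.single m c) \<le> d"
  by (auto simp: tdegree_le_iff split: if_splits)

lemma poly_as_indexed_sum:
  fixes p :: "'n::finite rpoly"
  assumes ms: "bij_betw ms {..<M} {m. mdeg m \<le> d}" and "tdegree p \<le> d"
  shows "p = (\<Sum>a<M. Poly_Mapping.single (ms a) (Poly_Mapping.lookup p (ms a)))"
proof -
  have "p = (\<Sum>m\<in>{m. mdeg m \<le> d}. Poly_Mapping.single m (Poly_Mapping.lookup p m))"
    using assms by (intro poly_as_sum finite_mdeg_le) (auto simp: tdegree_le_iff)
  then show ?thesis
    unfolding sum.reindex_bij_betw[OF ms, of "\<lambda>m. Poly_Mapping.single m (Poly_Mapping.lookup p m)"] .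
qed

lemma obtain_monomials:
  obtains M and ms :: "nat \<Rightarrow> 'n::finite \<Rightarrow>\<^sub>0 nat" where "bij_betw ms {..<M} {m. mdeg m \<le> d}"
  using ex_bij_betw_nat_finite[OF finite_mdeg_le, of d] by (auto simp: atLeast0LessThan)

lemma sos_upto_iff_gram:
  assumes ms: "bij_betw ms {..<M} {m :: 'n::finite \<Rightarrow>\<^sub>0 nat. mdeg m \<le> d}"
  shows "p \<in> sos_upto (2 * d) \<longleftrightarrow>
    (\<exists>Y. psd_matrix M Y \<and> p = (\<Sum>a<M. \<Sum>b<M. Poly_Mapping.single (ms a + ms b) (Y a b)))"
proof
  assume "p \<in> sos_upto (2 * d)"
  then obtain l :: nat and h where p: "p = (\<Sum>j<l. (h j)\<^sup>2)" and deg: "tdegree p \<le> 2 * d"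
    unfolding sos_upto_def by blast
  define c where "c = (\<lambda>j a. Poly_Mapping.lookup (h j) (ms a))"
  define Y where "Y = (\<lambda>a b. \<Sum>j<l. c j a * c j b)"
  have h: "h j = (\<Sum>a<M. Poly_Mapping.single (ms a) (c j a))" if "j < l" for j
    unfolding c_def using deg that
    by (intro poly_as_indexed_sum[OF ms] sum_squares_degree[of h l]) (auto simp: p)
  have "p = (\<Sum>j<l. \<Sum>a<M. \<Sum>b<M. Poly_Mapping.single (ms a + ms b) (c j a * c j b))"
    unfolding p by (intro sum.cong refl, subst h) (auto simp: power2_eq_square sum_product mult_single)
  also have "\<dots> = (\<Sum>a<M. \<Sum>b<M. \<Sum>j<l. Poly_Mapping.single (ms a + ms b) (c j a * c j b))"
    by (subst sum.swap) (intro sum.cong refl sum.swap)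
  also have "\<dots> = (\<Sum>a<M. \<Sum>b<M. Poly_Mapping.single (ms a + ms b) (Y a b))"
    unfolding Y_def by (simp only: single_eq_Const_mult[of _ "_ * _"] single_eq_Const_mult[of _ "sum _ _"]
        Const_sum sum_distrib_right)
  finally have "p = (\<Sum>a<M. \<Sum>b<M. Poly_Mapping.single (ms a + ms b) (Y a b))" .
  moreover have "psd_matrix M Y"
    unfolding psd_matrix_def sym_matrix_def
  proof (intro conjI allI impI)
    show "Y a b = Y b a" for a b
      by (simp add: Y_def mult.commute)
    fix x :: "nat \<Rightarrow> real"
    have "(\<Sum>a<M. \<Sum>b<M. Y a b * x a * x b) = (\<Sum>a<M. \<Sum>b<M. \<Sum>j<l. (c j a * x a) * (c j b * x b))"
      by (simp add: Y_def sum_distrib_right sum_distrib_left mult_ac)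
    also have "\<dots> = (\<Sum>j<l. \<Sum>a<M. \<Sum>b<M. (c j a * x a) * (c j b * x b))"
      by (subst (2) sum.swap) (intro sum.cong refl sum.swap)
    also have "\<dots> = (\<Sum>j<l. (\<Sum>a<M. c j a * x a)\<^sup>2)"
      by (simp add: power2_eq_square sum_product)
    also have "\<dots> \<ge> 0"
      by (intro sum_nonneg) auto
    finally show "0 \<le> (\<Sum>a<M. \<Sum>b<M. Y a b * x a * x b)" .
  qed
  ultimately show "\<exists>Y. psd_matrix M Y \<and> p = (\<Sum>a<M. \<Sum>b<M. Poly_Mapping.single (ms a + ms b) (Y a b))"
    by blast
next
  assume "\<exists>Y. psd_matrix M Y \<and> p = (\<Sum>a<M. \<Sum>b<M. Poly_Mapping.single (ms a + ms b) (Y a b))"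
  then obtain Y where Y: "psd_matrix M Y" and p: "p = (\<Sum>a<M. \<Sum>b<M. Poly_Mapping.single (ms a + ms b) (Y a b))"
    by blast
  obtain l :: nat and c where c: "\<And>a b. a < M \<Longrightarrow> b < M \<Longrightarrow> Y a b = (\<Sum>j<l. c j a * c j b)"
    using psd_matrix_factorization[OF Y] by blast
  have "p = (\<Sum>a<M. \<Sum>b<M. \<Sum>j<l. Poly_Mapping.single (ms a + ms b) (c j a * c j b))"
    unfolding p
  proof (intro sum.cong refl)
    fix a b assume "a \<in> {..<M}" "b \<in> {..<M}"
    then show "Poly_Mapping.single (ms a + ms b) (Y a b) = (\<Sum>j<l. Poly_Mapping.single (ms a + ms b) (c j a * c j b))"
      by (simp only: c lessThan_iff single_eq_Const_mult[of _ "_ * _"] single_eq_Const_mult[of _ "sum _ _"]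
        Const_sum sum_distrib_right)
  qed
  also have "\<dots> = (\<Sum>j<l. \<Sum>a<M. \<Sum>b<M. Poly_Mapping.single (ms a + ms b) (c j a * c j b))"
    by (subst (2) sum.swap) (intro sum.cong refl sum.swap)
  also have "\<dots> = (\<Sum>j<l. (\<Sum>a<M. Poly_Mapping.single (ms a) (c j a))\<^sup>2)"
    by (simp add: power2_eq_square sum_product mult_single)
  finally have "p = (\<Sum>j<l. (\<Sum>a<M. Poly_Mapping.single (ms a) (c j a))\<^sup>2)" .
  moreover have "tdegree p \<le> 2 * d"
    unfolding p
  proof (intro tdegree_sum_le tdegree_single_le)
    fix a b assume "a \<in> {..<M}" "b \<in> {..<M}"
    then have "mdeg (ms a) \<le> d" "mdeg (ms b) \<le> d"
      using bij_betw_apply[OF ms] by auto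
    then show "mdeg (ms a + ms b) \<le> 2 * d"
      by simp
  qed
  ultimately show "p \<in> sos_upto (2 * d)"
    unfolding sos_upto_def
    by (intro CollectI conjI exI[of _ l] exI[of _ "\<lambda>j. \<Sum>a<M. Poly_Mapping.single (ms a) (c j a)"])
qed

lemma sos_upto_0: "sos_upto 0 = {Const u | u. 0 \<le> u}"
proof (intro equalityI subsetI)
  fix p :: "'a rpoly" assume p: "p \<in> sos_upto 0"
  then have deg: "tdegree p \<le> 0"
    by (simp add: sos_upto_def)
  have "Poly_Mapping.keys p \<subseteq> {0}"
  proof
    fix m assume "m \<in> Poly_Mapping.keys p"
    then have "mdeg m = 0"
      using deg tdegree_le_iff[of p 0] by blast
    then show "m \<in> {0}"
      by (auto intro!: poly_mapping_eqI)
  qed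
  then have "p = Const (Poly_Mapping.lookup p 0)"
    using poly_as_sum[of "{0}" p] by (simp add: Const_def)
  moreover from this have "0 \<le> Poly_Mapping.lookup p 0"
    using sos_upto_nonneg[OF p, of 0] by (metis peval_Const)
  ultimately show "p \<in> {Const u | u. 0 \<le> u}"
    by blast
next
  fix p :: "'a rpoly" assume "p \<in> {Const u | u. 0 \<le> u}"
  then obtain u where u: "p = Const u" "0 \<le> u"
    by blast
  then have "p = (\<Sum>j<(1::nat). (Const (sqrt u))\<^sup>2)"
    by (simp add: power2_eq_square Const_mult[symmetric])
  moreover have "tdegree p \<le> 0"
    unfolding u Const_def by (rule tdegree_single_le) simp
  ultimately show "p \<in> sos_upto 0"
    unfolding sos_upto_def by (intro CollectI conjI exI[of _ 1] exI[of _ "\<lambda>_. Const (sqrt u)"])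
qed

section \<open>Sets described by linear matrix inequalities\<close>

text \<open>The linear combination of the families \<open>B j\<close> with real coefficients \<open>y j\<close>. The unknowns of a
  sum-of-squares problem together form a family of polynomials, with components indexed by \<open>'s\<close>.\<close>

definition family_comb :: "nat \<Rightarrow> (nat \<Rightarrow> 's \<Rightarrow> 'n rpoly) \<Rightarrow> (nat \<Rightarrow> real) \<Rightarrow> 's \<Rightarrow> 'n rpoly" where
  "family_comb N B y = (\<lambda>s. \<Sum>j<N. Const (y j) * B j s)"

text \<open>A set of families is LMI representable if it is the image of the feasible set of an LMI program
  under a linear map, given by the images \<open>B j\<close> of the unit vectors.\<close>

definition lmi_rep :: "('s \<Rightarrow> 'n rpoly) set \<Rightarrow> bool" where
  "lmi_rep S \<longleftrightarrow> (\<exists>P B. lmi_wf P \<and> family_comb (lmi_nvars P) B ` lmi_feasible P = S)"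

lemma lmi_rep_span: "lmi_rep (range (family_comb N B))"
proof -
  define P where "P = \<lparr>lmi_nvars = N, lmi_cost = (\<lambda>_. 0), lmi_blocks = [], lmi_eqs = []\<rparr>"
  have "family_comb N B y \<in> family_comb N B ` lmi_feasible P" for y
    by (rule image_eqI[of _ _ "\<lambda>j. if j < N then y j else 0"])
      (auto simp: family_comb_def lmi_feasible_def P_def)
  then have "family_comb (lmi_nvars P) B ` lmi_feasible P = range (family_comb N B)"
    by (auto simp: P_def)
  moreover have "lmi_wf P"
    by (simp add: P_def lmi_wf_def)
  ultimately show ?thesis
    unfolding lmi_rep_def by blast
qed

lemma lmi_rep_polys_upto:
  "lmi_rep {c :: 's \<Rightarrow> 'n::finite rpoly. c i \<in> polys_upto d \<and> (\<forall>s. s \<noteq> i \<longrightarrow> c s = 0)}" (is "lmi_rep ?S")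
proof -
  obtain M and ms :: "nat \<Rightarrow> 'n \<Rightarrow>\<^sub>0 nat" where ms: "bij_betw ms {..<M} {m. mdeg m \<le> d}"
    by (rule obtain_monomials)
  define B :: "nat \<Rightarrow> 's \<Rightarrow> 'n rpoly" where "B = (\<lambda>j s. if s = i then monomial (ms j) else 0)"
  have comb: "family_comb M B y = (\<lambda>s. if s = i then \<Sum>a<M. Poly_Mapping.single (ms a) (y a) else 0)" for y
    by (auto simp: family_comb_def B_def fun_eq_iff single_eq_Const_mult[of _ "y _"])
  have "family_comb M B y \<in> ?S" for y
    unfolding comb using bij_betw_apply[OF ms]
    by (auto simp: polys_upto_def intro!: tdegree_sum_le tdegree_single_le)
  moreover have "c \<in> range (family_comb M B)" if "c \<in> ?S" for c
  proof -
    have "c = family_comb M B (\<lambda>a. Poly_Mapping.lookup (c i) (ms a))"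
      unfolding comb using that poly_as_indexed_sum[OF ms, of "c i"] by (auto simp: polys_upto_def fun_eq_iff)
    then show ?thesis
      by blast
  qed
  ultimately have "range (family_comb M B) = ?S"
    by blast
  then show ?thesis
    using lmi_rep_span[of M B] by simp
qed

lemma sum_div_mod:
  fixes F :: "nat \<Rightarrow> nat \<Rightarrow> 'a::comm_monoid_add"
  shows "(\<Sum>j<M * M. F (j div M) (j mod M)) = (\<Sum>a<M. \<Sum>b<M. F a b)"
proof -
  have "(\<Sum>a<M. \<Sum>b<M. F a b) = (\<Sum>(a, b)\<in>{..<M} \<times> {..<M}. F a b)"
    by (rule sum.cartesian_product)
  also have "\<dots> = (\<Sum>j<M * M. F (j div M) (j mod M))"
  proof (rule sum.reindex_bij_witness[where i = "\<lambda>j. (j div M, j mod M)" and j = "\<lambda>(a, b). a * M + b"])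
    fix ab assume ab: "ab \<in> {..<M} \<times> {..<M}"
    then obtain a b where "ab = (a, b)" "a < M" "b < M"
      by auto
    moreover from this have "a * M + b < M * M"
      using mult_le_mono1[of "Suc a" M M] by simp
    ultimately show "(case ab of (a, b) \<Rightarrow> a * M + b) \<in> {..<M * M}"
      by simp
  next
    fix j assume j: "j \<in> {..<M * M}"
    then have "M > 0"
      by (cases M) auto
    then show "(j div M, j mod M) \<in> {..<M} \<times> {..<M}"
      using j by (auto simp: less_mult_imp_div_less)
  qed auto
  finally show ?thesis
    by simp
qed

text \<open>The variables are the entries of an arbitrary square matrix, of which only the symmetric part
  matters and is constrained.\<close>
lemma lmi_rep_sos_upto:
  "lmi_rep {c :: 's \<Rightarrow> 'n::finite rpoly. c i \<in> sos_upto (2 * d) \<and> (\<forall>s. s \<noteq> i \<longrightarrow> c s = 0)}" (is "lmi_rep ?S")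
proof -
  obtain M and ms :: "nat \<Rightarrow> 'n \<Rightarrow>\<^sub>0 nat" where ms: "bij_betw ms {..<M} {m. mdeg m \<le> d}"
    by (rule obtain_monomials)
  define B :: "nat \<Rightarrow> 's \<Rightarrow> 'n rpoly" where
    "B = (\<lambda>j s. if s = i then monomial (ms (j div M) + ms (j mod M)) else 0)"
  define A :: "nat \<Rightarrow> nat \<Rightarrow> nat \<Rightarrow> real" where
    "A = (\<lambda>n a b. if n = 0 then 0 else
       ((if (n - 1) div M = a \<and> (n - 1) mod M = b then 1 else 0) +
        (if (n - 1) div M = b \<and> (n - 1) mod M = a then 1 else 0)) / 2)"
  define P where "P = \<lparr>lmi_nvars = M * M, lmi_cost = (\<lambda>_. 0), lmi_blocks = [(M, A)], lmi_eqs = []\<rparr>"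
  define Y :: "(nat \<Rightarrow> real) \<Rightarrow> nat \<Rightarrow> nat \<Rightarrow> real" where
    "Y = (\<lambda>y a b. (y (a * M + b) + y (b * M + a)) / 2)"
  have wf: "lmi_wf P"
    by (auto simp: lmi_wf_def P_def sym_matrix_def A_def)
  have block: "A 0 a b + (\<Sum>j<M * M. y j * A (Suc j) a b) = Y y a b" if "a < M" "b < M" for y a b
  proof -
    have "(\<Sum>j<M * M. y j * A (Suc j) a b) =
        (\<Sum>j<M * M. y ((j div M) * M + j mod M) *
          (((if j div M = a \<and> j mod M = b then 1 else 0) + (if j div M = b \<and> j mod M = a then 1 else 0)) / 2))"
      by (simp add: A_def)
    also have "\<dots> = (\<Sum>a'<M. \<Sum>b'<M. y (a' * M + b') *
          (((if a' = a \<and> b' = b then 1 else 0) + (if a' = b \<and> b' = a then 1 else 0)) / 2))"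
      by (rule sum_div_mod)
    also have "\<dots> = (\<Sum>a'<M. \<Sum>b'<M. if b' = b then (if a' = a then y (a' * M + b') / 2 else 0) else 0) +
        (\<Sum>a'<M. \<Sum>b'<M. if b' = a then (if a' = b then y (a' * M + b') / 2 else 0) else 0)"
      unfolding sum.distrib[symmetric] by (intro sum.cong refl) (auto simp: algebra_simps)
    also have "\<dots> = Y y a b"
      using that by (simp add: Y_def add_divide_distrib)
    finally show ?thesis
      by (simp add: A_def)
  qed
  have feasible: "y \<in> lmi_feasible P \<longleftrightarrow> (\<forall>j\<ge>M * M. y j = 0) \<and> psd_matrix M (Y y)" for y
  proof -
    have "psd_matrix M (\<lambda>a b. A 0 a b + (\<Sum>j<M * M. y j * A (Suc j) a b)) \<longleftrightarrow> psd_matrix M (Y y)"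
      by (rule psd_matrix_cong) (rule block)
    then show ?thesis
      by (simp add: lmi_feasible_def P_def)
  qed
  have comb: "family_comb (M * M) B y =
      (\<lambda>s. if s = i then \<Sum>a<M. \<Sum>b<M. Poly_Mapping.single (ms a + ms b) (Y y a b) else 0)" for y
  proof
    fix s
    let ?F = "\<lambda>a b. Poly_Mapping.single (ms a + ms b) (y (a * M + b) / 2)"
    have "(\<Sum>j<M * M. Const (y j) * monomial (ms (j div M) + ms (j mod M))) =
        (\<Sum>j<M * M. ?F (j div M) (j mod M) + ?F (j div M) (j mod M))"
      by (simp add: single_add[symmetric] single_eq_Const_mult[of _ "y _"])
    also have "\<dots> = (\<Sum>a<M. \<Sum>b<M. ?F a b + ?F a b)"
      by (rule sum_div_mod)
    also have "\<dots> = (\<Sum>a<M. \<Sum>b<M. ?F a b) + (\<Sum>a<M. \<Sum>b<M. ?F b a)"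
      unfolding sum.distrib by (subst (3) sum.swap) (rule refl)
    also have "\<dots> = (\<Sum>a<M. \<Sum>b<M. Poly_Mapping.single (ms a + ms b) (Y y a b))"
      unfolding sum.distrib[symmetric] Y_def
      by (simp add: single_add[symmetric] add_divide_distrib add.commute)
    finally show "family_comb (M * M) B y s =
        (if s = i then \<Sum>a<M. \<Sum>b<M. Poly_Mapping.single (ms a + ms b) (Y y a b) else 0)"
      by (simp add: family_comb_def B_def)
  qed
  have "family_comb (M * M) B y \<in> ?S" if "y \<in> lmi_feasible P" for y
    using that sos_upto_iff_gram[OF ms] unfolding feasible comb by auto
  moreover have "c \<in> family_comb (M * M) B ` lmi_feasible P" if c: "c \<in> ?S" for c
  proof -
    obtain G where G: "psd_matrix M G" "c i = (\<Sum>a<M. \<Sum>b<M. Poly_Mapping.single (ms a + ms b) (G a b))"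
      using c sos_upto_iff_gram[OF ms] by auto
    define y where "y = (\<lambda>j. if j < M * M then G (j div M) (j mod M) else 0)"
    have Y: "Y y a b = G a b" if "a < M" "b < M" for a b
    proof -
      have "a * M + b < M * M" "b * M + a < M * M"
        using mult_le_mono1[of "Suc a" M M] mult_le_mono1[of "Suc b" M M] that by simp_all
      then show ?thesis
        using G(1) that by (simp add: Y_def y_def psd_matrix_def sym_matrix_def)
    qed
    have "y \<in> lmi_feasible P"
      using psd_matrix_cong[OF Y] G(1) unfolding feasible by (simp add: y_def)
    moreover have "c = family_comb (M * M) B y"
      unfolding comb using c G(2) Y by (auto simp: fun_eq_iff intro!: sum.cong)
    ultimately show ?thesis
      by blast
  qed
  ultimately have "family_comb (lmi_nvars P) B ` lmi_feasible P = ?S"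
    by (auto simp: P_def)
  then show ?thesis
    unfolding lmi_rep_def using wf by blast
qed

lemma sum_lessThan_add:
  fixes F :: "nat \<Rightarrow> 'a::comm_monoid_add"
  shows "(\<Sum>j<N1 + N2. F j) = (\<Sum>j<N1. F j) + (\<Sum>j<N2. F (N1 + j))"
  by (induction N2) (simp_all add: add.assoc)

text \<open>For a Minkowski sum, the two programs are run side by side: the variables of the second one are
  numbered after those of the first, and each block and equation ignores the foreign variables.\<close>
lemma lmi_rep_add:
  assumes "lmi_rep S1" "lmi_rep S2"
  shows "lmi_rep {\<lambda>s. c s + d s | c d. c \<in> S1 \<and> d \<in> S2}"
proof -
  obtain P1 B1 where P1: "lmi_wf P1" "family_comb (lmi_nvars P1) B1 ` lmi_feasible P1 = S1"
    using assms(1) unfolding lmi_rep_def by blast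
  obtain P2 B2 where P2: "lmi_wf P2" "family_comb (lmi_nvars P2) B2 ` lmi_feasible P2 = S2"
    using assms(2) unfolding lmi_rep_def by blast
  let ?N1 = "lmi_nvars P1" and ?N2 = "lmi_nvars P2"
  define blk1 where "blk1 = (\<lambda>(m :: nat, A :: nat \<Rightarrow> nat \<Rightarrow> nat \<Rightarrow> real).
    (m, \<lambda>j. if j \<le> ?N1 then A j else (\<lambda>_ _. 0)))"
  define blk2 where "blk2 = (\<lambda>(m :: nat, A :: nat \<Rightarrow> nat \<Rightarrow> nat \<Rightarrow> real).
    (m, \<lambda>j. if j = 0 then A 0 else if j \<le> ?N1 then (\<lambda>_ _. 0) else A (j - ?N1)))"
  define eq1 where "eq1 = (\<lambda>(a :: nat \<Rightarrow> real, e :: real). (\<lambda>j. if j < ?N1 then a j else 0, e))"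
  define eq2 where "eq2 = (\<lambda>(a :: nat \<Rightarrow> real, e :: real). (\<lambda>j. if j < ?N1 then 0 else a (j - ?N1), e))"
  define P where "P = \<lparr>lmi_nvars = ?N1 + ?N2, lmi_cost = (\<lambda>_. 0),
    lmi_blocks = map blk1 (lmi_blocks P1) @ map blk2 (lmi_blocks P2),
    lmi_eqs = map eq1 (lmi_eqs P1) @ map eq2 (lmi_eqs P2)\<rparr>"
  define B where "B = (\<lambda>j. if j < ?N1 then B1 j else B2 (j - ?N1))"
  define left where "left = (\<lambda>(y :: nat \<Rightarrow> real) j. if j < ?N1 then y j else 0)"
  define right where "right = (\<lambda>(y :: nat \<Rightarrow> real) j. y (?N1 + j))"
  have "lmi_wf P"
    using P1(1) P2(1) unfolding lmi_wf_def P_def blk1_def blk2_def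
    by (fastforce simp: sym_matrix_def)
  have sum_split: "(\<Sum>j<?N1 + ?N2. y j * (if j < ?N1 then a j else b (j - ?N1))) =
      (\<Sum>j<?N1. left y j * a j) + (\<Sum>j<?N2. right y j * b j)" for y and a b :: "nat \<Rightarrow> real"
    by (simp add: sum_lessThan_add left_def right_def)
  have sum_left: "(\<Sum>j<?N1 + ?N2. y j * (if j < ?N1 then a j else 0)) = (\<Sum>j<?N1. left y j * a j)"
    and sum_right: "(\<Sum>j<?N1 + ?N2. y j * (if j < ?N1 then 0 else a (j - ?N1))) = (\<Sum>j<?N2. right y j * a j)"
    for y and a :: "nat \<Rightarrow> real"
    using sum_split[of y a "\<lambda>_. 0"] sum_split[of y "\<lambda>_. 0" a] by simp_all
  have feasible: "y \<in> lmi_feasible P \<longleftrightarrow> left y \<in> lmi_feasible P1 \<and> right y \<in> lmi_feasible P2" for y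
  proof -
    have zero: "(\<forall>j\<ge>?N1 + ?N2. y j = 0) \<longleftrightarrow> (\<forall>j\<ge>?N1. left y j = 0) \<and> (\<forall>j\<ge>?N2. right y j = 0)"
    proof -
      have "y j = 0" if "\<forall>i\<ge>?N2. y (?N1 + i) = 0" "?N1 + ?N2 \<le> j" for j
        using that(1)[rule_format, of "j - ?N1"] that(2) by simp
      then show ?thesis
        by (auto simp: left_def right_def)
    qed
    have blocks1: "(\<lambda>a b. snd (blk1 mA) 0 a b + (\<Sum>j<?N1 + ?N2. y j * snd (blk1 mA) (Suc j) a b)) =
        (\<lambda>a b. snd mA 0 a b + (\<Sum>j<?N1. left y j * snd mA (Suc j) a b))" for mA
    proof (intro ext)
      fix a b
      have "(\<Sum>j<?N1 + ?N2. y j * snd (blk1 mA) (Suc j) a b) =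
          (\<Sum>j<?N1 + ?N2. y j * (if j < ?N1 then snd mA (Suc j) a b else 0))"
        by (intro sum.cong) (auto simp: blk1_def split_beta)
      then show "snd (blk1 mA) 0 a b + (\<Sum>j<?N1 + ?N2. y j * snd (blk1 mA) (Suc j) a b) =
          snd mA 0 a b + (\<Sum>j<?N1. left y j * snd mA (Suc j) a b)"
        by (simp add: sum_left) (simp add: blk1_def split_beta)
    qed
    have blocks2: "(\<lambda>a b. snd (blk2 mA) 0 a b + (\<Sum>j<?N1 + ?N2. y j * snd (blk2 mA) (Suc j) a b)) =
        (\<lambda>a b. snd mA 0 a b + (\<Sum>j<?N2. right y j * snd mA (Suc j) a b))" for mA
    proof (intro ext)
      fix a b
      have "(\<Sum>j<?N1 + ?N2. y j * snd (blk2 mA) (Suc j) a b) =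
          (\<Sum>j<?N1 + ?N2. y j * (if j < ?N1 then 0 else snd mA (Suc (j - ?N1)) a b))"
        by (intro sum.cong) (auto simp: blk2_def split_beta Suc_diff_le)
      then show "snd (blk2 mA) 0 a b + (\<Sum>j<?N1 + ?N2. y j * snd (blk2 mA) (Suc j) a b) =
          snd mA 0 a b + (\<Sum>j<?N2. right y j * snd mA (Suc j) a b)"
        using sum_right[of y "\<lambda>j. snd mA (Suc j) a b"] by (simp add: blk2_def split_beta)
    qed
    have eqs1: "(\<Sum>j<?N1 + ?N2. fst (eq1 ae) j * y j) = (\<Sum>j<?N1. fst ae j * left y j)" for ae
      using sum_left[of y "fst ae"] by (simp add: eq1_def split_beta mult.commute)
    have eqs2: "(\<Sum>j<?N1 + ?N2. fst (eq2 ae) j * y j) = (\<Sum>j<?N2. fst ae j * right y j)" for ae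
      using sum_right[of y "fst ae"] by (simp add: eq2_def split_beta mult.commute)
    have fst_blk: "fst (blk1 mA) = fst mA" "fst (blk2 mA) = fst mA" for mA
      by (simp_all add: blk1_def blk2_def split_beta)
    have snd_eq: "snd (eq1 ae) = snd ae" "snd (eq2 ae) = snd ae" for ae
      by (simp_all add: eq1_def eq2_def split_beta)
    show ?thesis
      unfolding lmi_feasible_def mem_Collect_eq P_def lmi_program.simps zero set_append set_map
        ball_Un ball_simps split_beta fst_blk snd_eq blocks1 blocks2 eqs1 eqs2
      by blast
  qed
  have comb: "family_comb (?N1 + ?N2) B y =
      (\<lambda>s. family_comb ?N1 B1 (left y) s + family_comb ?N2 B2 (right y) s)" for y
    by (simp add: family_comb_def B_def sum_lessThan_add left_def right_def)
  have "family_comb (lmi_nvars P) B ` lmi_feasible P = {\<lambda>s. c s + d s | c d. c \<in> S1 \<and> d \<in> S2}"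
  proof (intro equalityI subsetI)
    fix x assume "x \<in> family_comb (lmi_nvars P) B ` lmi_feasible P"
    then obtain y where "y \<in> lmi_feasible P" "x = family_comb (?N1 + ?N2) B y"
      by (auto simp: P_def)
    then show "x \<in> {\<lambda>s. c s + d s | c d. c \<in> S1 \<and> d \<in> S2}"
      unfolding feasible comb P1(2)[symmetric] P2(2)[symmetric] by blast
  next
    fix x assume "x \<in> {\<lambda>s. c s + d s | c d. c \<in> S1 \<and> d \<in> S2}"
    then obtain y1 y2 where y: "y1 \<in> lmi_feasible P1" "y2 \<in> lmi_feasible P2"
      and x: "x = (\<lambda>s. family_comb ?N1 B1 y1 s + family_comb ?N2 B2 y2 s)"
      unfolding P1(2)[symmetric] P2(2)[symmetric] by blast
    define y where "y = (\<lambda>j. if j < ?N1 then y1 j else y2 (j - ?N1))"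
    have "left y = y1" "right y = y2"
      using y by (auto simp: left_def right_def y_def lmi_feasible_def fun_eq_iff)
    then have "y \<in> lmi_feasible P"
      using y unfolding feasible by simp
    moreover have "x = family_comb (lmi_nvars P) B y"
      using \<open>left y = y1\<close> \<open>right y = y2\<close> comb[of y] by (simp add: x P_def)
    ultimately show "x \<in> family_comb (lmi_nvars P) B ` lmi_feasible P"
      by blast
  qed
  with \<open>lmi_wf P\<close> show ?thesis
    unfolding lmi_rep_def by blast
qed

lemma lmi_rep_product:
  fixes C :: "'s \<Rightarrow> 'n::finite rpoly set"
  assumes "finite (UNIV :: 's set)"
    and C: "\<And>i. lmi_rep {c. c i \<in> C i \<and> (\<forall>s. s \<noteq> i \<longrightarrow> c s = 0)}"
  shows "lmi_rep {c. \<forall>s. c s \<in> C s}"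
proof -
  have "lmi_rep {c. (\<forall>s\<in>A. c s \<in> C s) \<and> (\<forall>s. s \<notin> A \<longrightarrow> c s = 0)}" if "finite A" for A
    using that
  proof (induction A rule: finite_induct)
    case empty
    have "range (family_comb 0 (\<lambda>_ _. 0)) = {c :: 's \<Rightarrow> 'n rpoly. \<forall>s. c s = 0}"
      by (auto simp: family_comb_def fun_eq_iff)
    then show ?case
      using lmi_rep_span[of 0 "\<lambda>_ (_ :: 's). 0 :: 'n rpoly"] by simp
  next
    case (insert i A)
    let ?S = "\<lambda>A. {c. (\<forall>s\<in>A. c s \<in> C s) \<and> (\<forall>s. s \<notin> A \<longrightarrow> c s = 0)}"
    let ?T = "{c. c i \<in> C i \<and> (\<forall>s. s \<noteq> i \<longrightarrow> c s = 0)}"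
    have "{\<lambda>s. c s + d s | c d. c \<in> ?T \<and> d \<in> ?S A} = ?S (insert i A)"
    proof (intro equalityI subsetI)
      fix x assume "x \<in> {\<lambda>s. c s + d s | c d. c \<in> ?T \<and> d \<in> ?S A}"
      then obtain c d where cd: "x = (\<lambda>s. c s + d s)" "c \<in> ?T" "d \<in> ?S A"
        by blast
      have "d i = 0"
        using cd(3) insert.hyps by simp
      moreover have "c s = 0" if "s \<noteq> i" for s
        using cd(2) that by simp
      ultimately show "x \<in> ?S (insert i A)"
        using cd insert.hyps by (auto simp: cd(1)) (metis add.left_neutral)+
    next
      fix x assume x: "x \<in> ?S (insert i A)"
      have "x = (\<lambda>s. (if s = i then x i else 0) + (if s = i then 0 else x s))"
        by auto
      moreover have "(\<lambda>s. if s = i then x i else 0) \<in> ?T"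
        using x by auto
      moreover have "(\<lambda>s. if s = i then 0 else x s) \<in> ?S A"
        using x insert.hyps by auto
      ultimately show "x \<in> {\<lambda>s. c s + d s | c d. c \<in> ?T \<and> d \<in> ?S A}"
        by - (rule CollectI, rule exI[of _ "\<lambda>s. if s = i then x i else 0"],
            rule exI[of _ "\<lambda>s. if s = i then 0 else x s"], rule conjI, assumption, rule conjI)
    qed
    then show ?case
      using lmi_rep_add[OF C[of i] insert.IH] by simp
  qed
  from this[OF assms(1)] show ?thesis
    by simp
qed

text \<open>Linearity over the real scalars, of a map from families to polynomials.\<close>
definition poly_linear :: "(('s \<Rightarrow> 'n rpoly) \<Rightarrow> 'n rpoly) \<Rightarrow> bool" where
  "poly_linear L \<longleftrightarrow> (\<forall>c d. L (\<lambda>s. c s + d s) = L c + L d) \<and> (\<forall>a c. L (\<lambda>s. Const a * c s) = Const a * L c)"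

lemma poly_linearD:
  assumes "poly_linear L"
  shows "L (\<lambda>s. c s + d s) = L c + L d" "L (\<lambda>s. Const a * c s) = Const a * L c"
  using assms unfolding poly_linear_def by blast+

lemma poly_linear_family_comb:
  assumes L: "poly_linear L"
  shows "L (family_comb N B y) = (\<Sum>j<N. Const (y j) * L (B j))"
proof (induction N)
  case 0
  show ?case
    using poly_linearD(2)[OF L, of 0 "\<lambda>_. 0"] by (simp add: family_comb_def)
next
  case (Suc N)
  have "L (family_comb (Suc N) B y) = L (\<lambda>s. family_comb N B y s + Const (y N) * B N s)"
    by (simp add: family_comb_def)
  also have "\<dots> = L (family_comb N B y) + Const (y N) * L (B N)"
    unfolding poly_linearD[OF L] ..
  finally show ?case
    using Suc by simp
qed

text \<open>A linear identity between polynomials amounts to one linear equation for each of the finitely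
  many monomials that occur in the data.\<close>
lemma lmi_rep_equation:
  assumes "lmi_rep S" and L: "poly_linear L"
  shows "lmi_rep {c\<in>S. L c = d}"
proof -
  obtain P B where P: "lmi_wf P" "family_comb (lmi_nvars P) B ` lmi_feasible P = S"
    using assms(1) unfolding lmi_rep_def by blast
  let ?N = "lmi_nvars P"
  have "finite ((\<Union>j<?N. Poly_Mapping.keys (L (B j))) \<union> Poly_Mapping.keys d)"
    by simp
  then obtain ks where ks: "set ks = (\<Union>j<?N. Poly_Mapping.keys (L (B j))) \<union> Poly_Mapping.keys d"
    using finite_list by blast
  define P' where "P' = P\<lparr>lmi_eqs := lmi_eqs P @
    map (\<lambda>m. (\<lambda>j. Poly_Mapping.lookup (L (B j)) m, Poly_Mapping.lookup d m)) ks\<rparr>"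
  have coeffs: "(\<forall>m\<in>set ks. (\<Sum>j<?N. Poly_Mapping.lookup (L (B j)) m * y j) = Poly_Mapping.lookup d m) \<longleftrightarrow>
      L (family_comb ?N B y) = d" (is "?lhs \<longleftrightarrow> ?rhs") for y
  proof -
    have lookup: "Poly_Mapping.lookup (L (family_comb ?N B y)) m =
        (\<Sum>j<?N. Poly_Mapping.lookup (L (B j)) m * y j)" for m
      by (simp add: poly_linear_family_comb[OF L] lookup_sum mult.commute)
    have "(\<Sum>j<?N. Poly_Mapping.lookup (L (B j)) m * y j) = Poly_Mapping.lookup d m" if "m \<notin> set ks" for m
      using that by (auto simp: ks in_keys_iff intro!: sum.neutral)
    then have "?lhs \<longleftrightarrow> (\<forall>m. (\<Sum>j<?N. Poly_Mapping.lookup (L (B j)) m * y j) = Poly_Mapping.lookup d m)"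
      by blast
    also have "\<dots> \<longleftrightarrow> ?rhs"
      by (simp add: poly_mapping_eq_iff fun_eq_iff lookup)
    finally show ?thesis .
  qed
  have "y \<in> lmi_feasible P' \<longleftrightarrow> y \<in> lmi_feasible P \<and> L (family_comb ?N B y) = d" for y
    unfolding coeffs[symmetric] by (auto simp: lmi_feasible_def P'_def ball_Un)
  then have "family_comb (lmi_nvars P') B ` lmi_feasible P' = {c\<in>S. L c = d}"
    unfolding P(2)[symmetric] by (auto simp: P'_def)
  moreover have "lmi_wf P'"
    using P(1) by (simp add: lmi_wf_def P'_def)
  ultimately show ?thesis
    unfolding lmi_rep_def by blast
qed

section \<open>The sum-of-squares problem as an LMI problem\<close>

text \<open>The slots index the unknowns of the sum-of-squares problem, so that a candidate solution is a
  family of polynomials. The scalar \<open>u\<close> is held as a constant polynomial.\<close>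
datatype 'm slot = Slot_u | Slot_v | Slot_w | Slot_p0 | Slot_q0 | Slot_s0 | Slot_t0 | Slot_r
  | Slot_p 'm | Slot_q 'm | Slot_s 'm | Slot_t 'm

lemma finite_slots: "finite (UNIV :: 'm::finite slot set)"
proof -
  have "(UNIV :: 'm slot set) = {Slot_u, Slot_v, Slot_w, Slot_p0, Slot_q0, Slot_s0, Slot_t0, Slot_r} \<union>
      range Slot_p \<union> range Slot_q \<union> range Slot_s \<union> range Slot_t"
  proof (intro equalityI subsetI)
    fix s :: "'m slot"
    show "s \<in> {Slot_u, Slot_v, Slot_w, Slot_p0, Slot_q0, Slot_s0, Slot_t0, Slot_r} \<union>
        range Slot_p \<union> range Slot_q \<union> range Slot_s \<union> range Slot_t"
      by (cases s) auto
  qed auto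
  also have "finite \<dots>"
    by simp
  finally show ?thesis .
qed

text \<open>\<open>of_slots\<close> reads off the constant coefficient of the \<open>u\<close>-slot, which makes it linear on all
  families; \<open>to_slots\<close> is a right inverse.\<close>
definition of_slots :: "('m slot \<Rightarrow> 'n rpoly) \<Rightarrow> ('n, 'm) sos_vars" where
  "of_slots c = \<lparr>sol_u = Poly_Mapping.lookup (c Slot_u) 0, sol_v = c Slot_v, sol_w = c Slot_w,
     sol_p0 = c Slot_p0, sol_p = (\<lambda>i. c (Slot_p i)), sol_q0 = c Slot_q0, sol_q = (\<lambda>i. c (Slot_q i)),
     sol_s0 = c Slot_s0, sol_s = (\<lambda>i. c (Slot_s i)), sol_t0 = c Slot_t0, sol_t = (\<lambda>i. c (Slot_t i)),
     sol_r = c Slot_r\<rparr>"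

lemma of_slots_sel [simp]:
  "sol_u (of_slots c) = Poly_Mapping.lookup (c Slot_u) 0" "sol_v (of_slots c) = c Slot_v"
  "sol_w (of_slots c) = c Slot_w" "sol_p0 (of_slots c) = c Slot_p0"
  "sol_p (of_slots c) i = c (Slot_p i)" "sol_q0 (of_slots c) = c Slot_q0"
  "sol_q (of_slots c) i = c (Slot_q i)" "sol_s0 (of_slots c) = c Slot_s0"
  "sol_s (of_slots c) i = c (Slot_s i)" "sol_t0 (of_slots c) = c Slot_t0"
  "sol_t (of_slots c) i = c (Slot_t i)" "sol_r (of_slots c) = c Slot_r"
  by (simp_all add: of_slots_def)

fun to_slots :: "('n, 'm) sos_vars \<Rightarrow> 'm slot \<Rightarrow> 'n rpoly" where
  "to_slots z Slot_u = Const (sol_u z)"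
| "to_slots z Slot_v = sol_v z"
| "to_slots z Slot_w = sol_w z"
| "to_slots z Slot_p0 = sol_p0 z"
| "to_slots z Slot_q0 = sol_q0 z"
| "to_slots z Slot_s0 = sol_s0 z"
| "to_slots z Slot_t0 = sol_t0 z"
| "to_slots z Slot_r = sol_r z"
| "to_slots z (Slot_p i) = sol_p z i"
| "to_slots z (Slot_q i) = sol_q z i"
| "to_slots z (Slot_s i) = sol_s z i"
| "to_slots z (Slot_t i) = sol_t z i"

lemma of_slots_to_slots: "of_slots (to_slots z) = z"
  by (simp add: of_slots_def Const_def)

lemma lin_comb_of_slots: "lin_comb N (\<lambda>j. of_slots (B j)) y = of_slots (family_comb N B y)"
  by (simp add: lin_comb_def of_slots_def family_comb_def lookup_sum)

text \<open>The constraint on each unknown apart from the polynomial identities. The condition \<open>u \<ge> 0\<close> says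
  that \<open>u\<close> is a sum of squares of degree \<open>0\<close>.\<close>
fun slot_cone :: "('n \<Rightarrow> 'n rpoly) \<Rightarrow> ('m::finite \<Rightarrow> 'n::finite rpoly) \<Rightarrow> nat \<Rightarrow> 'm slot \<Rightarrow> 'n rpoly set" where
  "slot_cone f g k Slot_u = sos_upto 0"
| "slot_cone f g k Slot_v = polys_upto (2 * k)"
| "slot_cone f g k Slot_w = polys_upto (2 * k)"
| "slot_cone f g k Slot_p0 = sos_upto (2 * D_order f k)"
| "slot_cone f g k Slot_q0 = sos_upto (2 * k)"
| "slot_cone f g k Slot_s0 = sos_upto (2 * k)"
| "slot_cone f g k Slot_t0 = sos_upto (2 * k)"
| "slot_cone f g k Slot_r = polys_upto (2 * (k - kappa g))"
| "slot_cone f g k (Slot_p i) = sos_upto (2 * (D_order f k - half_deg (tdegree (g i))))"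
| "slot_cone f g k (Slot_q i) = sos_upto (2 * (k - half_deg (tdegree (g i))))"
| "slot_cone f g k (Slot_s i) = sos_upto (2 * (k - half_deg (tdegree (g i))))"
| "slot_cone f g k (Slot_t i) = sos_upto (2 * (k - half_deg (tdegree (g i))))"

lemma lmi_rep_slot_cone:
  "lmi_rep {c. c i \<in> slot_cone f g k i \<and> (\<forall>s. s \<noteq> i \<longrightarrow> c s = 0)}"
proof (cases i)
  case Slot_u
  then show ?thesis
    using lmi_rep_sos_upto[of Slot_u 0] by simp
qed (simp_all add: lmi_rep_sos_upto lmi_rep_polys_upto)

text \<open>The four polynomial identities with all unknowns moved to one side. In the second one the
  constant \<open>1\<close> remains on the other side, so that every residual is linear.\<close>
definition residual_p where
  "residual_p f g c = c Slot_u - grad_dot (c Slot_v) f - c Slot_p0 - (\<Sum>i\<in>UNIV. c (Slot_p i) * g i)"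

definition residual_q where
  "residual_q g c = c Slot_w - c Slot_v - c Slot_q0 - (\<Sum>i\<in>UNIV. c (Slot_q i) * g i)"

definition residual_s where
  "residual_s g c = c Slot_w - c Slot_s0 - (\<Sum>i\<in>UNIV. c (Slot_s i) * g i)"

definition residual_t where
  "residual_t g c = c Slot_v - c Slot_t0 - (\<Sum>i\<in>UNIV. c (Slot_t i) * g i) - c Slot_r * (\<Prod>i\<in>UNIV. g i)"

lemma poly_linear_residuals:
  "poly_linear (residual_p f g)" "poly_linear (residual_q g)"
  "poly_linear (residual_s g)" "poly_linear (residual_t g)"
  unfolding poly_linear_def residual_p_def residual_q_def residual_s_def residual_t_def
  by (auto simp: grad_dot_add distrib_right sum.distrib)
    (simp_all add: grad_dot_Const_mult right_diff_distrib sum_distrib_left mult.assoc)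

lemma residual_iff:
  "residual_p f g c = 0 \<longleftrightarrow> c Slot_u - grad_dot (c Slot_v) f = c Slot_p0 + (\<Sum>i\<in>UNIV. c (Slot_p i) * g i)"
  "residual_q g c = 1 \<longleftrightarrow> c Slot_w - c Slot_v - 1 = c Slot_q0 + (\<Sum>i\<in>UNIV. c (Slot_q i) * g i)"
  "residual_s g c = 0 \<longleftrightarrow> c Slot_w = c Slot_s0 + (\<Sum>i\<in>UNIV. c (Slot_s i) * g i)"
  "residual_t g c = 0 \<longleftrightarrow>
    c Slot_v = c Slot_t0 + (\<Sum>i\<in>UNIV. c (Slot_t i) * g i) + c Slot_r * (\<Prod>i\<in>UNIV. g i)"
  unfolding residual_p_def residual_q_def residual_s_def residual_t_def
  by (simp_all only: diff_eq_eq) (auto simp: add_ac)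

lemma sos_feasible_eq_image:
  "sos_feasible f g k = of_slots ` {c. (\<forall>s. c s \<in> slot_cone f g k s) \<and>
     residual_p f g c = 0 \<and> residual_q g c = 1 \<and> residual_s g c = 0 \<and> residual_t g c = 0}"
  (is "_ = of_slots ` ?S")
proof (intro equalityI subsetI)
  fix z assume z: "z \<in> sos_feasible f g k"
  have "to_slots z s \<in> slot_cone f g k s" for s
    using z by (cases s) (auto simp: sos_feasible_def sos_upto_0)
  moreover have "residual_p f g (to_slots z) = 0" "residual_q g (to_slots z) = 1"
    "residual_s g (to_slots z) = 0" "residual_t g (to_slots z) = 0"
    using z unfolding sos_feasible_def mem_Collect_eq residual_iff to_slots.simps by blast+
  ultimately have "to_slots z \<in> ?S"
    by blast
  then have "of_slots (to_slots z) \<in> of_slots ` ?S"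
    by (rule imageI)
  then show "z \<in> of_slots ` ?S"
    unfolding of_slots_to_slots .
next
  fix z assume "z \<in> of_slots ` ?S"
  then obtain c where z: "z = of_slots c" and cone: "\<And>s. c s \<in> slot_cone f g k s"
    and residuals: "residual_p f g c = 0" "residual_q g c = 1" "residual_s g c = 0" "residual_t g c = 0"
    by blast
  obtain u where u: "c Slot_u = Const u" "0 \<le> u"
    using cone[of Slot_u] by (auto simp: sos_upto_0)
  have indexed: "c (Slot_p i) \<in> sos_upto (2 * (D_order f k - half_deg (tdegree (g i))))"
      "c (Slot_q i) \<in> sos_upto (2 * (k - half_deg (tdegree (g i)))) \<and>
       c (Slot_s i) \<in> sos_upto (2 * (k - half_deg (tdegree (g i)))) \<and>
       c (Slot_t i) \<in> sos_upto (2 * (k - half_deg (tdegree (g i))))" for i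
    using cone[of "Slot_p i"] cone[of "Slot_q i"] cone[of "Slot_s i"] cone[of "Slot_t i"] by simp_all
  have single: "c Slot_v \<in> polys_upto (2 * k)" "c Slot_w \<in> polys_upto (2 * k)"
      "c Slot_q0 \<in> sos_upto (2 * k)" "c Slot_s0 \<in> sos_upto (2 * k)" "c Slot_t0 \<in> sos_upto (2 * k)"
      "c Slot_r \<in> polys_upto (2 * (k - kappa g))" "c Slot_p0 \<in> sos_upto (2 * D_order f k)"
    using cone[of Slot_v] cone[of Slot_w] cone[of Slot_q0] cone[of Slot_s0] cone[of Slot_t0]
      cone[of Slot_r] cone[of Slot_p0] by simp_all
  have "0 \<le> sol_u z" "Const (sol_u z) = c Slot_u"
    using u by (simp_all add: z Const_def)
  then show "z \<in> sos_feasible f g k"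
    unfolding sos_feasible_def mem_Collect_eq
    using indexed single residuals[unfolded residual_iff] unfolding z of_slots_sel
    by (intro conjI allI) (assumption | simp only:)+
qed

lemma sos_objective_lin_comb:
  assumes "compact (semialg g)"
  shows "sos_objective g T (lin_comb N B y) = (\<Sum>j<N. y j * sos_objective g T (B j))"
proof -
  let ?h = "\<lambda>p x. indicator (semialg g) x *\<^sub>R peval p x"
  have integrable: "integrable lebesgue (?h p)" for p
  proof -
    have "integrable lborel (?h p)"
      using assms by (rule borel_integrable_compact) (rule continuous_on_peval)
    then show ?thesis
      by (simp only: integrable_completion[OF borel_measurable_integrable])
  qed
  have "(LINT x:semialg g|lebesgue. peval (sol_w (lin_comb N B y)) x) =
      integral\<^sup>L lebesgue (\<lambda>x. \<Sum>j<N. y j * ?h (sol_w (B j)) x)"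
    by (simp add: set_lebesgue_integral_def lin_comb_def sum_distrib_left mult.left_commute)
  also have "\<dots> = (\<Sum>j<N. integral\<^sup>L lebesgue (\<lambda>x. y j * ?h (sol_w (B j)) x))"
    by (intro Bochner_Integration.integral_sum integrable_mult_right integrable)
  also have "\<dots> = (\<Sum>j<N. y j * (LINT x:semialg g|lebesgue. peval (sol_w (B j)) x))"
    by (simp only: integral_mult_right_zero set_lebesgue_integral_def)
  finally show ?thesis
    by (simp add: sos_objective_def lin_comb_def sum_distrib_left sum_distrib_right sum.distrib algebra_simps)
qed

lemma is_lmi_problem_sos:
  fixes g :: "'m::finite \<Rightarrow> 'n::finite rpoly"
  assumes "compact (semialg g)"
  shows "is_lmi_problem (sos_feasible f g k) (sos_objective g T)"
proof -
  let ?cones = "{c. \<forall>s. c s \<in> slot_cone f g k s}"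
  have "lmi_rep {c \<in> {c \<in> {c \<in> {c \<in> ?cones. residual_p f g c = 0}. residual_q g c = 1}.
      residual_s g c = 0}. residual_t g c = 0}"
    by (intro lmi_rep_equation lmi_rep_product finite_slots lmi_rep_slot_cone poly_linear_residuals)
  then obtain P B where wf: "lmi_wf P"
    and P: "family_comb (lmi_nvars P) B ` lmi_feasible P = {c. (\<forall>s. c s \<in> slot_cone f g k s) \<and>
     residual_p f g c = 0 \<and> residual_q g c = 1 \<and> residual_s g c = 0 \<and> residual_t g c = 0}"
    unfolding lmi_rep_def by auto
  define B' where "B' = (\<lambda>j. of_slots (B j))"
  define P' where "P' = P\<lparr>lmi_cost := (\<lambda>j. sos_objective g T (B' j))\<rparr>"
  have "lmi_feasible P' = lmi_feasible P"
    by (simp add: lmi_feasible_def P'_def)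
  then have "lin_comb (lmi_nvars P') B' ` lmi_feasible P' = of_slots ` family_comb (lmi_nvars P) B ` lmi_feasible P"
    by (simp add: P'_def B'_def lin_comb_of_slots image_image)
  then have "lin_comb (lmi_nvars P') B' ` lmi_feasible P' = sos_feasible f g k"
    unfolding P sos_feasible_eq_image .
  moreover have "lmi_wf P'"
    using wf by (simp add: lmi_wf_def P'_def)
  moreover have "sos_objective g T (lin_comb (lmi_nvars P') B' y) = lmi_objective P' y" for y
    unfolding sos_objective_lin_comb[OF assms]
    by (simp add: lmi_objective_def P'_def mult.commute)
  ultimately show ?thesis
    unfolding is_lmi_problem_def by blast
qed

theorem theorem7:
  fixes f :: "'n::finite \<Rightarrow> 'n rpoly"
    and g :: "'m::finite \<Rightarrow> 'n rpoly"
    and T :: real and k :: nat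
  assumes "semialg g \<noteq> {}"
    and "compact (semialg g)"
    and "\<exists>e\<in>semialg g. lyapunov_stable_equilibrium (vector_field f) e"
    and "mean_exit_time (vector_field f) (semialg g) < \<infinity>"
    and "\<exists>i. \<exists>R>0. g i = Const (R\<^sup>2) - (\<Sum>j\<in>UNIV. (Var j)\<^sup>2)"
    and "T \<ge> 0"
    and "k \<ge> k_min f g"
  shows "is_lmi_problem (sos_feasible f g k) (sos_objective g T) \<and>
    (\<forall>z\<in>sos_feasible f g k.
       (\<forall>t\<ge>0. {x \<in> interior (semialg g). peval (sol_v z) x + sol_u z * t < 0}
                \<subseteq> inv_set (vector_field f) (semialg g) t) \<and>
       (sol_u z = 0 \<longrightarrow> {x \<in> interior (semialg g). peval (sol_v z) x < 0}
                \<subseteq> inv_set_infinity (vector_field f) (semialg g)))"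
proof (intro conjI ballI allI impI subsetI)
  show "is_lmi_problem (sos_feasible f g k) (sos_objective g T)"
    using assms(2) by (rule is_lmi_problem_sos)
next
  fix z t x
  assume "z \<in> sos_feasible f g k" "x \<in> {x \<in> interior (semialg g). peval (sol_v z) x + sol_u z * t < 0}"
  then show "x \<in> inv_set (vector_field f) (semialg g) t"
    using inner_approximation[OF _ assms(2), of z f k x t] by (auto simp: inv_set_def)
next
  fix z x
  assume "z \<in> sos_feasible f g k" "sol_u z = 0" "x \<in> {x \<in> interior (semialg g). peval (sol_v z) x < 0}"
  then show "x \<in> inv_set_infinity (vector_field f) (semialg g)"
    using inner_approximation[OF _ assms(2), of z f k x] by (auto simp: inv_set_infinity_def)
qed

end
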